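(* Let $d = 2^n$ with $n \ge 2$, and let $\mathcal{E}$ be a quantum channel on $\mathbb{C}^d$ that is unital and has no leakage, and that is moreover a unitary channel $\mathcal{E}(\hat\rho) = \hat X\hat\rho\hat X^\dagger$ for some $\hat X \in U(d)$. Let $F$, $D$, $r = 1-F$ and $u$ be the average fidelity, fidelity deviation, average infidelity and unitarity of $\mathcal{E}$. Define $$B_{ru}(r,u) := d^2 c_d \sqrt{u + \frac{2dr}{d-1} - 1},\qquad c_d := \frac12\sqrt{1 - \frac{1}{d^2}},$$ and $B_{FD}(F,D) := \sqrt{1 - c(F,D)^2}$ with $$c(F,D) := \left[\frac{P}{d} - \frac{\sqrt{(d-2)\bigl(dQ + d^2 - (d+2)P^2\bigr)}}{2d}\right]_+,$$ where $[x]_+ = \max\{x,0\}$, $P \ge 0$, $Q\ge 0$, $P^2 = d(d+1)F - d$ and $Q^2 = d(d+1)(d+2)(d+3)(D^2+F^2) - 2d(d+3) - 4(d+2)P^2$. Then $$d_\diamond(\mathcal{E},\mathcal{I}) \le \min\{B_{ru}(r,u),\, B_{FD}(F,D)\}.$$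
   Context: $d\psi$ denotes the Haar-induced probability measure on pure states of $\mathbb{C}^d$. For a channel $\mathcal{E}$: $f_{\mathcal{E}}(\psi) = \langle\psi|\mathcal{E}(|\psi\rangle\langle\psi|)|\psi\rangle$, average fidelity $F = \int d\psi\, f_{\mathcal{E}}(\psi)$, fidelity deviation $D = \sqrt{\int d\psi\, f_{\mathcal{E}}(\psi)^2 - F^2}$, average infidelity $r = 1-F$, and unitarity $u(\mathcal{E}) = \frac{d}{d-1}\int d\psi\, \mathrm{tr}\bigl[\mathcal{E}(|\psi\rangle\langle\psi| - \hat{\mathbb{1}}/d)^2\bigr]$. Unital means $\mathcal{E}(\hat{\mathbb 1}) = \hat{\mathbb 1}$. $\mathcal{I}$ is the identity channel, and $d_\diamond(\mathcal{E},\mathcal{F}) = \frac12\max_{\hat\rho}\|(\mathcal{E}\otimes\mathcal{I})(\hat\rho)-(\mathcal{F}\otimes\mathcal{I})(\hat\rho)\|_1$, the maximum over density operators on $\mathbb{C}^d\otimes\mathbb{C}^d$. *)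

theory Defs
  imports "HOL-Analysis.Analysis"
begin

type_synonym 'd cmat = "complex^'d^'d"

definition adj :: "complex^('n::finite)^('m::finite) \<Rightarrow> complex^'m^'n" where
  "adj A = (\<chi> i j. cnj (A $ j $ i))"

definition unitary_mat :: "('d::finite) cmat \<Rightarrow> bool" where
  "unitary_mat U \<longleftrightarrow> adj U ** U = mat 1 \<and> U ** adj U = mat 1"

definition ketbra :: "complex^('d::finite) \<Rightarrow> 'd cmat" where
  "ketbra psi = (\<chi> i j. psi $ i * cnj (psi $ j))"

definition qform :: "('d::finite) cmat \<Rightarrow> complex^'d \<Rightarrow> complex" where
  "qform A v = (\<Sum>i\<in>UNIV. \<Sum>j\<in>UNIV. cnj (v $ i) * A $ i $ j * v $ j)"

definition density_op :: "('d::finite) cmat \<Rightarrow> bool" where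
  "density_op rho \<longleftrightarrow> adj rho = rho \<and> (\<forall>v. Im (qform rho v) = 0 \<and> 0 \<le> Re (qform rho v))
      \<and> trace rho = 1"

text \<open>Trace norm = sum of the singular values (taken from a singular value decomposition
  A = U diag(s) V^dagger with U, V unitary and s \<ge> 0; the singular values are unique).\<close>
definition trace_norm :: "('d::finite) cmat \<Rightarrow> real" where
  "trace_norm A = (SOME t. \<exists>U V (s::real^'d). unitary_mat U \<and> unitary_mat V \<and> (\<forall>i. 0 \<le> s $ i)
      \<and> A = U ** (\<chi> i j. if i = j then complex_of_real (s $ i) else 0) ** adj V
      \<and> t = (\<Sum>i\<in>UNIV. s $ i))"

definition unitary_channel :: "('d::finite) cmat \<Rightarrow> 'd cmat \<Rightarrow> 'd cmat" where
  "unitary_channel X rho = X ** rho ** adj X"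

definition unital :: "(('d::finite) cmat \<Rightarrow> 'd cmat) \<Rightarrow> bool" where
  "unital E \<longleftrightarrow> E (mat 1) = mat 1"

definition trace_preserving :: "(('d::finite) cmat \<Rightarrow> 'd cmat) \<Rightarrow> bool" where
  "trace_preserving E \<longleftrightarrow> (\<forall>rho. trace (E rho) = trace rho)"

definition tensor_id :: "(('d::finite) cmat \<Rightarrow> 'd cmat) \<Rightarrow> ('d\<times>'d) cmat \<Rightarrow> ('d\<times>'d) cmat" where
  "tensor_id E R = (\<chi> p q. \<Sum>k\<in>UNIV. \<Sum>l\<in>UNIV.
      (if snd p = k \<and> snd q = l then 1 else 0) *
      E (\<chi> i j. R $ (i, k) $ (j, l)) $ fst p $ fst q)"

definition diamond_dist :: "(('d::finite) cmat \<Rightarrow> 'd cmat) \<Rightarrow> ('d cmat \<Rightarrow> 'd cmat) \<Rightarrow> real" where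
  "diamond_dist E G = (1/2) * (SUP rho \<in> {rho. density_op rho}.
      trace_norm (tensor_id E rho - tensor_id G rho))"

text \<open>Average over Haar-random pure states: uniform measure on the unit sphere of C^d,
  realised as the radial projection of the uniform (Lebesgue) measure on the unit ball.\<close>
definition haar_avg :: "(complex^('d::finite) \<Rightarrow> real) \<Rightarrow> real" where
  "haar_avg f = (LINT x : ball 0 1 | lborel. f (x /\<^sub>R norm x)) / measure lborel (ball (0::complex^'d) 1)"

definition fid_fun :: "(('d::finite) cmat \<Rightarrow> 'd cmat) \<Rightarrow> complex^'d \<Rightarrow> real" where
  "fid_fun E psi = Re (qform (E (ketbra psi)) psi)"

definition avg_fidelity :: "(('d::finite) cmat \<Rightarrow> 'd cmat) \<Rightarrow> real" where
  "avg_fidelity E = haar_avg (fid_fun E)"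

definition fid_deviation :: "(('d::finite) cmat \<Rightarrow> 'd cmat) \<Rightarrow> real" where
  "fid_deviation E = sqrt (haar_avg (\<lambda>psi. (fid_fun E psi)^2) - (avg_fidelity E)^2)"

definition unitarity :: "(('d::finite) cmat \<Rightarrow> 'd cmat) \<Rightarrow> real" where
  "unitarity E = (let d = real CARD('d) in
     d / (d - 1) * haar_avg (\<lambda>psi. Re (trace (
        (E (ketbra psi - mat (complex_of_real (1 / d)))) ** (E (ketbra psi - mat (complex_of_real (1 / d))))))))"

definition c_d :: "real \<Rightarrow> real" where
  "c_d d = (1/2) * sqrt (1 - 1 / d^2)"

definition B_ru :: "real \<Rightarrow> real \<Rightarrow> real \<Rightarrow> real" where
  "B_ru d r u = d^2 * c_d d * sqrt (u + 2 * d * r / (d - 1) - 1)"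

definition c_FD :: "real \<Rightarrow> real \<Rightarrow> real \<Rightarrow> real" where
  "c_FD d P Q = max 0 (P / d - sqrt ((d - 2) * (d * Q + d^2 - (d + 2) * P^2)) / (2 * d))"

definition B_FD :: "real \<Rightarrow> real \<Rightarrow> real \<Rightarrow> real" where
  "B_FD d P Q = sqrt (1 - (c_FD d P Q)^2)"

end

theory Submission
  imports Defs "HOL-Computational_Algebra.Fundamental_Theorem_Algebra"
begin

text \<open>Let \<open>l\<^sub>i\<close> be the eigenvalues of \<open>X\<close>, \<open>S = \<Sum> l\<^sub>i\<close> and \<open>S\<^sub>2 = \<Sum> l\<^sub>i\<^sup>2\<close>. The second and fourth
  moments of the Haar measure give \<open>P = |S|\<close> and \<open>Q = |S\<^sup>2 + S\<^sub>2|\<close>, and the unitarity is 1. If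
  the numerical range of \<open>X\<close> keeps distance \<open>B\<close> from the origin, then so does that of
  \<open>X \<otimes> 1\<close>, and the diamond distance is at most \<open>sqrt (1 - B\<^sup>2)\<close>.

  Rotate the phase so that \<open>S = P\<close> and put \<open>x\<^sub>i = Re l\<^sub>i\<close>. Then \<open>\<Sum> x\<^sub>i = P\<close> and
  \<open>P\<^sup>2 + 2 \<Sum> x\<^sub>i\<^sup>2 - d \<le> Q\<close>, so by Cauchy-Schwarz every pair has mean \<open>(x\<^sub>i + x\<^sub>j) / 2 \<ge> c(F, D)\<close>. If
  \<open>c(F, D) > 0\<close>, all eigenvalues lie on an arc shorter than \<open>\<pi>\<close>, and the chord of its
  two end points separates them from the origin at distance at least \<open>c(F, D)\<close>. For the other bound,
  \<open>x\<^sub>i \<ge> 1 - (d - P)\<close> and \<open>B\<^sub>r\<^sub>u = d sqrt ((d\<^sup>2 - P\<^sup>2) / 2)\<close>.\<close>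

text \<open>That the numerical range avoids a disc around the origin is always witnessed by a
  half-plane \<open>Re (w * z) \<ge> B\<close>. Such a bound adds up over the slices of a vector of
  the tensor product, which a bound on the modulus does not, and for a normal matrix it need only
  hold at the eigenvalues. Means of pairs are estimated, not single real parts, because one
  eigenvalue may well have negative real part: a further phase turns the half-plane, and only the
  two ends of the arc decide how large B may be. No integral over the sphere is ever computed.
  Linear isometries tie all moments of the numbers |x_i|^2 of one degree to a single constant, and
  the function that is 1 on the sphere, being a power of the sum of the |x_i|^2, fixes this
  constant. The bound \<open>B_ru\<close> exceeds what is needed by a wide margin, so a crude
  estimate of the real parts suffices for it, whereas \<open>B_FD\<close> uses Cauchy-Schwarz in its
  sharp form.\<close>

section \<open>Hermitian inner product, adjoints and isometries\<close>

definition cip :: "complex^('n::finite) \<Rightarrow> complex^'n \<Rightarrow> complex" where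
  "cip x y = (\<Sum>i\<in>UNIV. cnj (x $ i) * y $ i)"

lemma cip_add_left: "cip (x + y) z = cip x z + cip y z"
  by (simp add: cip_def sum.distrib algebra_simps)

lemma cip_add_right: "cip x (y + z) = cip x y + cip x z"
  by (simp add: cip_def sum.distrib algebra_simps)

lemma cip_diff_left: "cip (x - y) z = cip x z - cip y z"
  by (simp add: cip_def sum_subtractf algebra_simps)

lemma cip_diff_right: "cip x (y - z) = cip x y - cip x z"
  by (simp add: cip_def sum_subtractf algebra_simps)

lemma cip_scale_left: "cip (c *s x) y = cnj c * cip x y"
  by (simp add: cip_def sum_distrib_left algebra_simps)

lemma cip_scale_right: "cip x (c *s y) = c * cip x y"
  by (simp add: cip_def sum_distrib_left algebra_simps)

lemma cip_zero [simp]: "cip 0 x = 0" "cip x 0 = 0"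
  by (simp_all add: cip_def)

lemma cip_commute: "cip y x = cnj (cip x y)"
  by (simp add: cip_def algebra_simps)

lemma Re_cip: "Re (cip x y) = x \<bullet> y"
  by (simp add: cip_def inner_vec_def inner_complex_def)

lemma norm_vec_complex_sq: "(norm x)\<^sup>2 = (\<Sum>i\<in>UNIV. (cmod (x $ i))\<^sup>2)" for x :: "complex^'n::finite"
  by (simp add: norm_vec_def L2_set_def sum_nonneg)

lemma cip_self: "cip x x = complex_of_real ((norm x)\<^sup>2)"
proof -
  have "cip x x = (\<Sum>i\<in>UNIV. complex_of_real ((cmod (x $ i))\<^sup>2))"
    unfolding cip_def by (rule sum.cong) (simp_all add: complex_norm_square mult.commute del: of_real_power)
  then show ?thesis
    by (simp only: norm_vec_complex_sq of_real_sum)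
qed

lemma cip_adj: "cip x (A *v y) = cip (adj A *v x) y"
  for A :: "complex^'n::finite^'m::finite"
proof -
  have "cip x (A *v y) = (\<Sum>i\<in>UNIV. \<Sum>j\<in>UNIV. cnj (x $ i) * (A $ i $ j * y $ j))"
    by (simp add: cip_def matrix_vector_mult_def sum_distrib_left)
  also have "\<dots> = (\<Sum>j\<in>UNIV. \<Sum>i\<in>UNIV. cnj (x $ i) * (A $ i $ j * y $ j))"
    by (rule sum.swap)
  also have "\<dots> = cip (adj A *v x) y"
    by (simp add: cip_def matrix_vector_mult_def adj_def sum_distrib_left sum_distrib_right algebra_simps)
  finally show ?thesis .
qed

lemma norm_scale_vec: "norm (c *s x) = cmod c * norm x" for x :: "complex^'n::finite"
proof -
  have "norm (c *s x) ^ 2 = (cmod c * norm x) ^ 2"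
    by (simp add: norm_vec_complex_sq norm_mult power_mult_distrib sum_distrib_left)
  then show ?thesis
    using power2_eq_imp_eq[of "norm (c *s x)" "cmod c * norm x"] by simp
qed

lemma of_real_scale_vec: "complex_of_real c *s x = c *\<^sub>R x"
  by (simp add: vec_eq_iff scaleR_conv_of_real[where 'a = complex])

lemma exists_phase: "\<exists>w. cmod w = 1 \<and> w * z = complex_of_real (cmod z)"
proof (cases "z = 0")
  case False
  have "cnj z * z = complex_of_real ((cmod z)\<^sup>2)"
    by (metis complex_norm_square mult.commute)
  then have "cnj z / cmod z * z = complex_of_real (cmod z)"
    using False by (simp add: field_simps power2_eq_square)
  moreover have "cmod (cnj z / cmod z) = 1"
    using False by (simp add: norm_divide)
  ultimately show ?thesis by blast
qed (auto intro: exI[of _ 1])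

lemma cnj_mult_unit: "cmod w = 1 \<Longrightarrow> cnj w * w = 1"
  by (metis complex_norm_square mult.commute of_real_1 power_one)

lemma cip_Cauchy_Schwarz: "cmod (cip x y) \<le> norm x * norm y"
proof -
  obtain w where w: "cmod w = 1" "w * cip x y = complex_of_real (cmod (cip x y))"
    using exists_phase by blast
  have "cmod (cip x y) = Re (cip x (w *s y))"
    by (simp add: cip_scale_right w)
  also have "\<dots> \<le> norm x * norm (w *s y)"
    unfolding Re_cip by (rule norm_cauchy_schwarz)
  finally show ?thesis by (simp add: norm_scale_vec w)
qed

lemma adj_adj [simp]: "adj (adj A) = A"
  by (simp add: adj_def vec_eq_iff)

lemma adj_mult: "adj (A ** B) = adj B ** adj A"
  for A :: "complex^'n::finite^'m::finite" and B :: "complex^'k::finite^'n"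
  by (simp add: adj_def matrix_matrix_mult_def vec_eq_iff mult.commute)

lemma adj_diff: "adj (A - B) = adj A - adj B"
  by (simp add: adj_def vec_eq_iff)

lemma norm_unitary_mult:
  assumes "adj U ** U = mat 1"
  shows "norm (U *v x) = norm x"
proof -
  have "cip (U *v x) (U *v x) = cip x x"
    by (simp add: cip_adj matrix_vector_mul_assoc assms)
  then have "complex_of_real ((norm (U *v x))\<^sup>2) = complex_of_real ((norm x)\<^sup>2)"
    unfolding cip_self .
  then have "(norm (U *v x))\<^sup>2 = (norm x)\<^sup>2"
    using of_real_eq_iff by blast
  then show ?thesis by simp
qed

section \<open>Spectral theorem\<close>

definition diagm :: "('n::finite \<Rightarrow> complex) \<Rightarrow> complex^'n^'n" where
  "diagm l = (\<chi> i j. if i = j then l i else 0)"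

text \<open>The vector p(A) v, evaluated by Horner's scheme; no powers of matrices appear.\<close>

definition poly_act :: "complex^'n^'n::finite \<Rightarrow> complex^'n \<Rightarrow> complex poly \<Rightarrow> complex^'n" where
  "poly_act A v p = fold_coeffs (\<lambda>a w. a *s v + A *v w) p 0"

lemma poly_act_0 [simp]: "poly_act A v 0 = 0"
  by (simp add: poly_act_def)

lemma poly_act_pCons: "poly_act A v (pCons a p) = a *s v + A *v poly_act A v p"
  by (cases "a = 0 \<and> p = 0") (auto simp: poly_act_def vec_eq_iff)

lemma poly_act_add: "poly_act A v (p + q) = poly_act A v p + poly_act A v q"
proof (induction p q rule: poly_induct2)
  case (pCons a p b q)
  then show ?case
    by (simp add: poly_act_pCons vector_space_over_itself.scale_left_distrib algebra_simps vector_sadd_rdistrib)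
qed simp

lemma poly_act_smult: "poly_act A v (smult c p) = c *s poly_act A v p"
  by (induction p)
    (simp_all add: poly_act_pCons vector_add_ldistrib vector_scalar_commute vector_smult_assoc)

lemma poly_act_in_invariant:
  assumes "\<And>x y. x \<in> W \<Longrightarrow> y \<in> W \<Longrightarrow> x + y \<in> W" and "\<And>c x. x \<in> W \<Longrightarrow> c *s x \<in> W"
    and "\<And>x. x \<in> W \<Longrightarrow> A *v x \<in> W" and "v \<in> W"
  shows "poly_act A v p \<in> W"
proof (induction p)
  case 0
  show ?case using assms(2)[OF assms(4), of 0] by simp
qed (simp add: poly_act_pCons assms)

text \<open>With N the real dimension of the space, the N + 1 vectors v, A v, ..., A^N v are
  linearly dependent over the reals, and the coefficients of a dependence are those of p.\<close>

lemma poly_act_annihilator: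
  fixes A :: "complex^'n^'n::finite"
  shows "\<exists>p. p \<noteq> 0 \<and> poly_act A v p = 0"
proof -
  let ?N = "DIM(complex^'n)"
  let ?g = "\<lambda>i. poly_act A v (monom 1 i)"
  show ?thesis
  \<comment> \<open>Dependence is a property of the set of vectors, so coincidences among them are
    treated apart: there the difference of two monomials annihilates v.\<close>
  proof (cases "inj_on ?g {..?N}")
    case False
    then obtain i j where ij: "i \<noteq> j" "?g i = ?g j" by (auto simp: inj_on_def)
    have "poly_act A v (monom 1 i + smult (-1) (monom 1 j)) = 0"
      unfolding poly_act_add poly_act_smult ij by simp
    moreover have "coeff (monom 1 i + smult (-1) (monom 1 j)) i = (1::complex)"
      using ij by simp
    then have "monom 1 i + smult (-1) (monom 1 j) \<noteq> (0 :: complex poly)"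
      by (metis coeff_0 zero_neq_one)
    ultimately show ?thesis by blast
  next
    case True
    then have "card (?g ` {..?N}) = ?N + 1" by (simp add: card_image)
    then have "dependent (?g ` {..?N})"
      using dependent_biggerset[of "?g ` {..?N}"] by auto
    then obtain u where u: "\<exists>x\<in>?g ` {..?N}. u x \<noteq> 0" "(\<Sum>x\<in>?g ` {..?N}. u x *\<^sub>R x) = 0"
      unfolding dependent_finite[OF finite_imageI[OF finite_atMost]] by blast
    define p where "p = (\<Sum>i\<le>?N. smult (complex_of_real (u (?g i))) (monom 1 i))"
    have act_sum: "poly_act A v (\<Sum>i\<in>I. f i) = (\<Sum>i\<in>I. poly_act A v (f i))"
      if "finite I" for I and f :: "nat \<Rightarrow> complex poly"
      using that by (induction I rule: finite_induct) (simp_all add: poly_act_add)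
    have "poly_act A v p = (\<Sum>i\<le>?N. u (?g i) *\<^sub>R ?g i)"
      unfolding p_def
      by (subst act_sum) (auto simp: poly_act_smult of_real_scale_vec intro!: sum.cong)
    also have "\<dots> = 0" using u(2) sum.reindex[OF True, of "\<lambda>x. u x *\<^sub>R x"] by (simp add: o_def)
    finally have 1: "poly_act A v p = 0" .
    obtain k where k: "k \<le> ?N" "u (?g k) \<noteq> 0" using u(1) by auto
    have "coeff p k = complex_of_real (u (?g k))"
      using k(1) by (simp add: p_def coeff_sum if_distrib cong: if_cong)
    with k(2) have "p \<noteq> 0" by force
    with 1 show ?thesis by blast
  qed
qed

text \<open>Descent on the degree of an annihilating polynomial p = (X - a) q: either q(A) v is
  nonzero, hence an eigenvector for a lying in W, or q annihilates v as well. A nonzero constant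
  cannot annihilate v.\<close>

lemma eigenvector_in_invariant:
  fixes A :: "complex^'n^'n::finite"
  assumes W: "\<And>x y. x \<in> W \<Longrightarrow> y \<in> W \<Longrightarrow> x + y \<in> W" "\<And>c x. x \<in> W \<Longrightarrow> c *s x \<in> W"
      "\<And>x. x \<in> W \<Longrightarrow> A *v x \<in> W"
    and v: "v \<in> W" "v \<noteq> 0"
  shows "\<exists>w a. w \<in> W \<and> w \<noteq> 0 \<and> A *v w = a *s w"
proof -
  have "\<exists>w a. w \<in> W \<and> w \<noteq> 0 \<and> A *v w = a *s w" if "p \<noteq> 0" "poly_act A v p = 0" for p
    using that
  proof (induction "degree p" arbitrary: p rule: less_induct)
    case less
    have "degree p \<noteq> 0"
    proof
      assume "degree p = 0"
      then obtain c where c: "p = [:c:]" by (rule degree_eq_zeroE)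
      then have "c \<noteq> 0" "c *s v = 0" using less.prems by (auto simp: poly_act_pCons)
      then show False using v by (simp add: vec_eq_iff)
    qed
    then have "\<not> constant (poly p)" by (simp add: constant_degree)
    then obtain a where "poly p a = 0" using fundamental_theorem_of_algebra by blast
    then obtain q where q: "p = [:- a, 1:] * q" by (auto simp: poly_eq_0_iff_dvd)
    have q0: "q \<noteq> 0" using less.prems q by auto
    \<comment> \<open>Multiplication by X - a as a scaling plus a shift, for which
      \<open>poly_act\<close> has rules; it yields (A - a) q(A) v = 0.\<close>
    have "p = smult (-a) q + pCons 0 q" by (simp add: q)
    then have "poly_act A v p = (-a) *s poly_act A v q + (0 *s v + A *v poly_act A v q)"
      by (simp only: poly_act_add poly_act_smult poly_act_pCons)
    then have *: "A *v poly_act A v q = a *s poly_act A v q"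
      using less.prems(2) by (simp add: vec_eq_iff)
    show ?case
    proof (cases "poly_act A v q = 0")
      case True
      have "degree q < degree p" using q0 unfolding q by (subst degree_mult_eq) auto
      then show ?thesis using less.hyps q0 True by blast
    next
      case False
      then show ?thesis using * poly_act_in_invariant[OF W v(1)] by blast
    qed
  qed
  then show ?thesis using poly_act_annihilator by blast
qed

text \<open>A - a is normal along with A, and a normal matrix and its adjoint map each vector to
  vectors of equal length.\<close>

lemma normal_adj_eigenvector:
  assumes nrm: "adj A ** A = A ** adj A" and ev: "A *v w = a *s w"
  shows "adj A *v w = cnj a *s w"
proof -
  let ?x = "adj A *v w - cnj a *s w" and ?y = "A *v w - a *s w"
  have 1: "cip (adj A *v w) (adj A *v w) = cip (A *v w) (A *v w)"
    using cip_adj[of "A *v w" A w] cip_adj[of "adj A *v w" "adj A" w]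
    by (simp add: matrix_vector_mul_assoc nrm)
  have 2: "cip w (adj A *v w) = cip (A *v w) w" "cip (adj A *v w) w = cip w (A *v w)"
    by (simp_all add: cip_adj)
  have "cip ?x ?x = cip ?y ?y"
    by (simp add: cip_diff_left cip_diff_right cip_scale_left cip_scale_right 1 2 algebra_simps)
  then have "cip ?x ?x = 0" using ev by simp
  then show ?thesis by (simp add: cip_self)
qed

text \<open>Orthogonality for \<open>cip\<close> is real orthogonality to both \<open>f i\<close>
  and \<open>\<i> *s f i\<close>. These are at most \<open>2 * card I\<close> vectors, fewer than
  the real dimension \<open>2 * CARD('n)\<close>.\<close>

lemma exists_orthogonal_vector:
  fixes f :: "'n::finite \<Rightarrow> complex^'n"
  assumes "I \<noteq> UNIV"
  shows "\<exists>v. v \<noteq> 0 \<and> (\<forall>i\<in>I. cip (f i) v = 0)"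
proof -
  let ?S = "f ` I \<union> (\<lambda>i. \<i> *s f i) ` I"
  have "card I < CARD('n)" using assms by (simp add: psubset_card_mono psubsetI)
  have "dim ?S \<le> card ?S" by (rule dim_le_card') simp
  also have "\<dots> \<le> card (f ` I) + card ((\<lambda>i. \<i> *s f i) ` I)" by (rule card_Un_le)
  also have "\<dots> \<le> card I + card I" by (intro add_mono card_image_le) auto
  also have "\<dots> < DIM(complex^'n)" using \<open>card I < CARD('n)\<close> by simp
  finally obtain v where v: "v \<noteq> 0" "\<And>y. y \<in> span ?S \<Longrightarrow> orthogonal v y"
    using orthogonal_to_subspace_exists by metis
  have "cip (f i) v = 0" if "i \<in> I" for i
  proof (rule complex_eqI)
    have "orthogonal v (f i)" "orthogonal v (\<i> *s f i)"
      using that by (auto intro!: v(2) span_base)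
    then have "Re (cip (f i) v) = 0" "Re (cip (\<i> *s f i) v) = 0"
      unfolding Re_cip orthogonal_def by (simp_all add: inner_commute)
    then show "Re (cip (f i) v) = Re 0" "Im (cip (f i) v) = Im 0"
      by (simp_all add: cip_scale_left)
  qed
  then show ?thesis using v(1) by blast
qed

text \<open>The vectors orthogonal to the eigenvectors found so far form a subspace invariant under
  A, because those are eigenvectors of \<open>adj A\<close> too; it contains a further eigenvector.
  Induction over subsets of the index type leaves a family indexed by that type, ready to be the
  columns of a matrix.\<close>

lemma normal_eigenvectors:
  fixes A :: "complex^'n^'n::finite" and I :: "'n set"
  assumes nrm: "adj A ** A = A ** adj A"
  shows "\<exists>f l. (\<forall>i\<in>I. \<forall>j\<in>I. cip (f i) (f j) = (if i = j then 1 else 0)) \<and> (\<forall>i\<in>I. A *v f i = l i *s f i)"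
proof (induction I rule: finite_induct[OF finite])
  case (2 k I)
  then obtain f l where f: "\<And>i j. i \<in> I \<Longrightarrow> j \<in> I \<Longrightarrow> cip (f i) (f j) = (if i = j then 1 else 0)"
      and l: "\<And>i. i \<in> I \<Longrightarrow> A *v f i = l i *s f i" by metis
  let ?W = "{w. \<forall>i\<in>I. cip (f i) w = 0}"
  obtain v where v: "v \<in> ?W" "v \<noteq> 0"
    using exists_orthogonal_vector[of I f] \<open>k \<notin> I\<close> by blast
  have "\<exists>w a. w \<in> ?W \<and> w \<noteq> 0 \<and> A *v w = a *s w"
    by (rule eigenvector_in_invariant[OF _ _ _ v])
      (auto simp: cip_add_right cip_scale_right cip_scale_left cip_adj normal_adj_eigenvector[OF nrm l])
  then obtain w a where w: "w \<in> ?W" "w \<noteq> 0" "A *v w = a *s w" by blast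
  define u where "u = (complex_of_real (1 / norm w)) *s w"
  have u1: "cip u u = 1" 
    using w(2) by (simp add: cip_self u_def norm_scale_vec norm_divide)
  have u2: "cip (f i) u = 0" "cip u (f i) = 0" if "i \<in> I" for i
    using that w(1) by (simp_all add: u_def cip_scale_right cip_scale_left cip_commute[of w])
  have u3: "A *v u = a *s u"
    by (simp only: u_def vector_scalar_commute w(3)) (simp add: vec_eq_iff)
  show ?case
    by (rule exI[of _ "f(k := u)"], rule exI[of _ "l(k := a)"])
      (use \<open>k \<notin> I\<close> f l u1 u2 u3 in auto)
qed simp

theorem normal_spectral:
  fixes A :: "complex^'n^'n::finite"
  assumes "adj A ** A = A ** adj A"
  obtains V l where "unitary_mat V" "A = V ** diagm l ** adj V"
proof -
  obtain f :: "'n \<Rightarrow> complex^'n" and l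
    where f: "\<And>i j. cip (f i) (f j) = (if i = j then 1 else 0)"
      and l: "\<And>i. A *v f i = l i *s f i"
    using normal_eigenvectors[OF assms, of UNIV] by auto
  define V :: "complex^'n^'n" where "V = (\<chi> i j. f j $ i)"
  have 1: "adj V ** V = mat 1"
    using f by (simp add: V_def adj_def matrix_matrix_mult_def vec_eq_iff mat_def cip_def)
  then have 2: "V ** adj V = mat 1" using matrix_left_right_inverse by blast
  have "A ** V = V ** diagm l"
    using l by (simp add: V_def diagm_def matrix_matrix_mult_def matrix_vector_mult_def vec_eq_iff
        if_distrib mult.commute cong: if_cong)
  then have "V ** diagm l ** adj V = A"
    by (metis 2 matrix_mul_assoc matrix_mul_rid)
  with 1 2 show ?thesis by (intro that[of V l]) (auto simp: unitary_mat_def)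
qed

section \<open>Trace norm and diamond distance\<close>

lemma column_unitary_norm:
  assumes "unitary_mat V"
  shows "norm (column i V) = 1"
proof -
  have "cip (column i V) (column i V) = (adj V ** V) $ i $ i"
    by (simp add: cip_def column_def adj_def matrix_matrix_mult_def)
  then have "cip (column i V) (column i V) = 1"
    using assms by (simp add: unitary_mat_def mat_def)
  then have "complex_of_real ((norm (column i V))\<^sup>2) = of_real 1" by (simp add: cip_self)
  then have "(norm (column i V))\<^sup>2 = 1" unfolding of_real_eq_iff .
  then show ?thesis by (simp add: power2_eq_1_iff) (metis norm_ge_zero not_one_le_zero neg_0_le_iff_le)
qed

lemma spectral_eigenvector:
  assumes V: "unitary_mat V" and A: "A = V ** diagm l ** adj V"
  shows "A *v column i V = l i *s column i V"
proof -
  have "A ** V = V ** diagm l"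
    using V unfolding A by (metis matrix_mul_assoc matrix_mul_rid unitary_mat_def)
  then have "(A ** V) $ j $ i = (V ** diagm l) $ j $ i" for j by simp
  then show ?thesis
    by (simp add: vec_eq_iff matrix_matrix_mult_def matrix_vector_mult_def column_def diagm_def
      if_distrib mult.commute cong: if_cong)
qed

text \<open>For unitary V the weights add up to the squared norm of v, so the numerical range of a
  normal matrix is the convex hull of its eigenvalues.\<close>

lemma cip_spectral:
  fixes V :: "complex^'n::finite^'n"
  shows "cip v ((V ** diagm l ** adj V) *v v)
    = (\<Sum>i\<in>UNIV. l i * complex_of_real ((cmod ((adj V *v v) $ i))\<^sup>2))"
proof -
  let ?u = "adj V *v v"
  have "cip v ((V ** diagm l ** adj V) *v v) = cip ?u (diagm l *v ?u)"
    by (simp add: matrix_vector_mul_assoc[symmetric] cip_adj[of v V])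
  then show ?thesis
    unfolding cip_def complex_norm_square
    by (simp add: diagm_def matrix_vector_mult_def if_distrib[where f = "\<lambda>x. x * _"] mult_ac cong: if_cong)
qed

lemma sandwich_diag_entry:
  "(adj V ** M ** V) $ i $ i = cip (column i V) (M *v column i V)"
  for V :: "complex^'k::finite^'n::finite"
  by (simp add: matrix_mul_assoc[symmetric])
    (simp add: cip_def column_def adj_def matrix_matrix_mult_def matrix_vector_mult_def)

lemma trace_mult_spectral:
  "trace (M ** (V ** diagm p ** adj V)) = (\<Sum>i\<in>UNIV. p i * cip (column i V) (M *v column i V))"
proof -
  have "trace (M ** (V ** diagm p ** adj V)) = trace (diagm p ** (adj V ** M ** V))"
    by (metis matrix_mul_assoc trace_mul_sym)
  also have "\<dots> = (\<Sum>i\<in>UNIV. p i * (adj V ** M ** V) $ i $ i)"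
    by (simp add: trace_def diagm_def matrix_matrix_mult_def if_distrib[where f = "\<lambda>x. x * _"] cong: if_cong)
  finally show ?thesis by (simp only: sandwich_diag_entry)
qed

lemma unitary_mat_mult: "unitary_mat U \<Longrightarrow> unitary_mat V \<Longrightarrow> unitary_mat (U ** V)"
  unfolding unitary_mat_def adj_mult
  by (metis matrix_mul_assoc matrix_mul_rid)

lemma unitary_mat_adj: "unitary_mat U \<Longrightarrow> unitary_mat (adj U)"
  by (simp add: unitary_mat_def)

lemma unitary_diagm: 
  assumes "\<And>i. cmod (w i) = 1"
  shows "unitary_mat (diagm w)"
proof -
  have "cnj (w i) * w i = 1" for i
    by (rule cnj_mult_unit[OF assms])
  then show ?thesis
    by (simp add: unitary_mat_def diagm_def adj_def matrix_matrix_mult_def mat_def vec_eq_iff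
      if_distrib[where f = "\<lambda>x. x * _"] if_distrib[where f = cnj] mult.commute cong: if_cong)
qed

lemma diagm_mult: "diagm a ** diagm b = diagm (\<lambda>i. a i * b i)"
  by (simp add: diagm_def matrix_matrix_mult_def vec_eq_iff if_distrib[where f = "\<lambda>x. x * _"] cong: if_cong)

text \<open>Any singular value decomposition \<open>A = U S V\<^sup>\<dagger>\<close> has trace norm \<open>tr ((V U\<^sup>\<dagger>) A)\<close>, so the bound holds
  for whichever one \<open>SOME\<close> picks; one exists by the spectral theorem.\<close>
lemma trace_norm_le:
  fixes A :: "complex^'n::finite^'n"
  assumes nrm: "adj A ** A = A ** adj A"
    and K: "\<And>W. unitary_mat W \<Longrightarrow> cmod (trace (W ** A)) \<le> K"
  shows "trace_norm A \<le> K"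
proof -
  let ?P = "\<lambda>t. \<exists>U V (s::real^'n). unitary_mat U \<and> unitary_mat V \<and> (\<forall>i. 0 \<le> s $ i)
      \<and> A = U ** (\<chi> i j. if i = j then complex_of_real (s $ i) else 0) ** adj V
      \<and> t = (\<Sum>i\<in>UNIV. s $ i)"
  have dm: "(\<chi> i j. if i = j then complex_of_real (s $ i) else 0) = diagm (\<lambda>i. complex_of_real (s $ i))"
    for s :: "real^'n" by (simp add: diagm_def)
  have "Ex ?P"
  proof -
    obtain V l where V: "unitary_mat V" "A = V ** diagm l ** adj V"
      using normal_spectral[OF nrm] by blast
    \<comment> \<open>Splitting each eigenvalue into phase and modulus turns the diagonalisation
      into a singular value decomposition with left factor \<open>V ** diagm w\<close>.\<close>
    have "\<forall>i. \<exists>w. cmod w = 1 \<and> l i = w * complex_of_real (cmod (l i))"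
    proof
      fix i
      obtain w where w: "cmod w = 1" "w * l i = complex_of_real (cmod (l i))"
        using exists_phase by blast
      have "cnj w * w = 1"
        by (rule cnj_mult_unit[OF w(1)])
      then have "l i = cnj w * complex_of_real (cmod (l i))"
        by (metis w(2) mult.assoc mult_1)
      then show "\<exists>w. cmod w = 1 \<and> l i = w * complex_of_real (cmod (l i))"
        using w(1) by (metis complex_mod_cnj)
    qed
    then obtain w where w: "\<And>i. cmod (w i) = 1" "\<And>i. l i = w i * complex_of_real (cmod (l i))"
      by metis
    let ?s = "\<chi> i. cmod (l i)"
    have "diagm l = diagm w ** diagm (\<lambda>i. complex_of_real (?s $ i))"
      unfolding diagm_mult by (simp add: w(2)[symmetric])
    then have "A = (V ** diagm w) ** diagm (\<lambda>i. complex_of_real (?s $ i)) ** adj V"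
      using V(2) by (simp add: matrix_mul_assoc)
    then have "?P (\<Sum>i\<in>UNIV. ?s $ i)"
      unfolding dm using V(1) unitary_mat_mult[OF V(1) unitary_diagm[OF w(1)]]
      by (intro exI[of _ "V ** diagm w"] exI[of _ V] exI[of _ ?s]) auto
    then show ?thesis by blast
  qed
  then have "?P (trace_norm A)"
    unfolding trace_norm_def by (rule someI_ex)
  then obtain U V and s :: "real^'n" where U: "unitary_mat U" and V: "unitary_mat V"
    and A: "A = U ** diagm (\<lambda>i. complex_of_real (s $ i)) ** adj V" and t: "trace_norm A = (\<Sum>i\<in>UNIV. s $ i)"
    unfolding dm by blast
  have "(V ** adj U) ** A = V ** diagm (\<lambda>i. complex_of_real (s $ i)) ** adj V"
    unfolding A using U by (metis matrix_mul_assoc matrix_mul_lid unitary_mat_def)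
  then have "trace ((V ** adj U) ** A) = (\<Sum>i\<in>UNIV. complex_of_real (s $ i))"
    using trace_mult_spectral[of "mat 1" V "\<lambda>i. complex_of_real (s $ i)"]
    by (simp add: cip_self column_unitary_norm[OF V])
  then have "cmod (trace ((V ** adj U) ** A)) = \<bar>trace_norm A\<bar>"
    unfolding t by (metis norm_of_real of_real_sum)
  then show ?thesis
    using K[OF unitary_mat_mult[OF V unitary_mat_adj[OF U]]] by linarith
qed

text \<open>With the phase of \<open>b\<close> chosen such that \<open>\<langle>a, b\<rangle> \<ge> 0\<close>, polarisation bounds the difference by
  \<open>|b - a| |b + a|\<close>.\<close>
lemma quadratic_form_diff_le:
  assumes W: "unitary_mat W" and n: "norm b = norm a"
    and B: "0 \<le> B" "B * (norm a)\<^sup>2 \<le> cmod (cip a b)"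
  shows "cmod (cip b (W *v b) - cip a (W *v a)) \<le> 2 * sqrt (1 - B\<^sup>2) * (norm a)\<^sup>2"
proof -
  have iso: "norm (W *v x) = norm x" for x
    using W by (intro norm_unitary_mult) (simp add: unitary_mat_def)
  obtain w where w: "cmod w = 1" "w * cip a b = complex_of_real (cmod (cip a b))"
    using exists_phase by blast
  define c where "c = cmod (cip a b)"
  define b' where "b' = w *s b"
  have nb: "norm b' = norm a" by (simp add: b'_def norm_scale_vec w n)
  have cb: "a \<bullet> b' = c"
    by (simp add: Re_cip[symmetric] b'_def cip_scale_right w c_def)
  have "cip b' (W *v b') = (cnj w * w) * cip b (W *v b)"
    by (simp add: b'_def cip_scale_right cip_scale_left vector_scalar_commute)
  moreover have "cnj w * w = 1"
    by (rule cnj_mult_unit[OF w(1)])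
  ultimately have eb: "cip b' (W *v b') = cip b (W *v b)" by simp
  have np: "(norm (b' + a))\<^sup>2 = 2 * (norm a)\<^sup>2 + 2 * c"
    using dot_norm[of a b'] cb nb by (simp add: add.commute)
  have nm: "(norm (b' - a))\<^sup>2 = 2 * (norm a)\<^sup>2 - 2 * c"
    using dot_norm_neg[of a b'] cb nb by (simp add: norm_minus_commute)
  have "2 * (cip b (W *v b) - cip a (W *v a))
      = cip (b' - a) (W *v (b' + a)) + cip (b' + a) (W *v (b' - a))"
    unfolding eb[symmetric]
    by (simp add: cip_diff_left cip_diff_right cip_add_left cip_add_right
        matrix_vector_right_distrib matrix_vector_mult_diff_distrib)
  then have "2 * cmod (cip b (W *v b) - cip a (W *v a))
      = cmod (cip (b' - a) (W *v (b' + a)) + cip (b' + a) (W *v (b' - a)))"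
    by (metis norm_mult norm_numeral)
  also have "\<dots> \<le> norm (b' - a) * norm (b' + a) + norm (b' + a) * norm (b' - a)"
    using cip_Cauchy_Schwarz iso by (metis add_mono norm_triangle_le)
  finally have 1: "cmod (cip b (W *v b) - cip a (W *v a)) \<le> norm (b' - a) * norm (b' + a)" by simp
  have "B\<^sup>2 * (norm a)^4 \<le> c\<^sup>2"
    using power_mono[OF B(2), of 2] B(1)
    by (simp add: c_def power_mult_distrib)
  moreover have "(norm (b' - a) * norm (b' + a))\<^sup>2 = 4 * ((norm a)^4 - c\<^sup>2)"
    unfolding power_mult_distrib np nm by (simp add: power2_eq_square power4_eq_xxxx algebra_simps)
  ultimately have "(norm (b' - a) * norm (b' + a))\<^sup>2 \<le> (1 - B\<^sup>2) * (2 * (norm a)\<^sup>2)\<^sup>2"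
    by (simp add: power_mult_distrib algebra_simps)
  then have "norm (b' - a) * norm (b' + a) \<le> sqrt ((1 - B\<^sup>2) * (2 * (norm a)\<^sup>2)\<^sup>2)"
    by (rule real_le_rsqrt)
  also have "\<dots> = 2 * sqrt (1 - B\<^sup>2) * (norm a)\<^sup>2"
    by (simp only: real_sqrt_mult real_sqrt_abs) simp
  finally show ?thesis using 1 by linarith
qed

lemma qform_cip: "qform A v = cip v (A *v v)"
  by (simp add: qform_def cip_def matrix_vector_mult_def sum_distrib_left algebra_simps)

lemma matrix_diff_ldistrib: "A ** (B - C) = A ** B - A ** C"
  for A :: "'a::ring_1^'n::finite^'m::finite"
  by (simp add: matrix_matrix_mult_def vec_eq_iff sum_subtractf algebra_simps)

lemma matrix_diff_rdistrib: "(A - B) ** C = A ** C - B ** C"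
  for A :: "'a::ring_1^'n::finite^'m::finite"
  by (simp add: matrix_matrix_mult_def vec_eq_iff sum_subtractf left_diff_distrib)

text \<open>Diagonalising R reduces the claim to pure states: the trace against a unitary W is a
  convex combination, with the eigenvalues of R as weights, of differences of the quadratic form of
  W at Y f and at f for eigenvectors f of R. The hypothesis \<open>num\<close> bounds the overlap of
  f and Y f from below.\<close>

lemma trace_norm_conj_diff_le:
  fixes Y R :: "complex^'n::finite^'n"
  assumes Y: "unitary_mat Y" and R: "density_op R" and B: "0 \<le> B"
    and num: "\<And>a. B * (norm a)\<^sup>2 \<le> cmod (cip a (Y *v a))"
  shows "trace_norm (Y ** R ** adj Y - R) \<le> 2 * sqrt (1 - B\<^sup>2)"
proof (rule trace_norm_le)
  have Rh: "adj R = R" using R by (simp add: density_op_def)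
  then have "adj (Y ** R ** adj Y - R) = Y ** R ** adj Y - R"
    by (simp add: adj_diff adj_mult matrix_mul_assoc)
  then show "adj (Y ** R ** adj Y - R) ** (Y ** R ** adj Y - R)
      = (Y ** R ** adj Y - R) ** adj (Y ** R ** adj Y - R)" by simp
  fix W :: "complex^'n^'n" assume W: "unitary_mat W"
  obtain V p where V: "unitary_mat V" and RV: "R = V ** diagm p ** adj V"
    using normal_spectral[of R] Rh by auto
  let ?f = "\<lambda>i. column i V"
  have "R *v ?f i = p i *s ?f i" for i
    by (rule spectral_eigenvector[OF V RV])
  then have pq: "p i = qform R (?f i)" for i
    by (simp add: qform_cip cip_scale_right cip_self column_unitary_norm[OF V])
  have p0: "0 \<le> Re (p i)" "p i = complex_of_real (Re (p i))" for i
    using R by (auto simp: pq density_op_def complex_eq_iff)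
  have "trace R = (\<Sum>i\<in>UNIV. p i)"
    using trace_mult_spectral[of "mat 1" V p]
    by (simp add: RV cip_self column_unitary_norm[OF V])
  then have p1: "(\<Sum>i\<in>UNIV. Re (p i)) = 1"
    using R by (simp add: density_op_def flip: Re_sum)
  have iso: "norm (Y *v x) = norm x" for x
    using Y by (intro norm_unitary_mult) (simp add: unitary_mat_def)
  have "trace (W ** (Y ** R ** adj Y)) = trace ((adj Y ** W ** Y) ** R)"
    by (metis matrix_mul_assoc trace_mul_sym)
  then have "trace (W ** (Y ** R ** adj Y - R)) = trace ((adj Y ** W ** Y) ** R) - trace (W ** R)"
    by (simp add: matrix_diff_ldistrib trace_sub)
  also have "\<dots> = (\<Sum>i\<in>UNIV. p i * (cip (?f i) ((adj Y ** W ** Y) *v ?f i) - cip (?f i) (W *v ?f i)))"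
    unfolding RV trace_mult_spectral by (simp add: sum_subtractf algebra_simps)
  also have "\<dots> = (\<Sum>i\<in>UNIV. p i * (cip (Y *v ?f i) (W *v (Y *v ?f i)) - cip (?f i) (W *v ?f i)))"
    by (simp add: matrix_vector_mul_assoc[symmetric] cip_adj[of _ "adj Y"])
  finally have "cmod (trace (W ** (Y ** R ** adj Y - R)))
      \<le> (\<Sum>i\<in>UNIV. cmod (p i * (cip (Y *v ?f i) (W *v (Y *v ?f i)) - cip (?f i) (W *v ?f i))))"
    by (simp add: norm_sum)
  also have "\<dots> \<le> (\<Sum>i\<in>UNIV. Re (p i) * (2 * sqrt (1 - B\<^sup>2)))"
  proof (rule sum_mono)
    fix i
    have "cmod (p i) = Re (p i)" using p0 by (metis abs_of_nonneg norm_of_real)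
    moreover have "cmod (cip (Y *v ?f i) (W *v (Y *v ?f i)) - cip (?f i) (W *v ?f i))
        \<le> 2 * sqrt (1 - B\<^sup>2) * (norm (?f i))\<^sup>2"
      by (rule quadratic_form_diff_le[OF W iso B num])
    ultimately show "cmod (p i * (cip (Y *v ?f i) (W *v (Y *v ?f i)) - cip (?f i) (W *v ?f i)))
        \<le> Re (p i) * (2 * sqrt (1 - B\<^sup>2))"
      using p0(1)[of i] by (simp add: norm_mult column_unitary_norm[OF V] mult_left_mono)
  qed
  also have "\<dots> = 2 * sqrt (1 - B\<^sup>2)"
    by (simp only: sum_distrib_right[symmetric] p1 mult_1)
  finally show "cmod (trace (W ** (Y ** R ** adj Y - R))) \<le> 2 * sqrt (1 - B\<^sup>2)" .
qed

section \<open>Tensoring with the identity on the reference system\<close>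

definition tensor_one :: "complex^'d::finite^'d \<Rightarrow> complex^('d \<times> 'd)^('d \<times> 'd)" where
  "tensor_one X = (\<chi> p q. if snd p = snd q then X $ fst p $ fst q else 0)"

lemma sum_prod_UNIV: "(\<Sum>p\<in>UNIV. f p) = (\<Sum>i\<in>UNIV. \<Sum>k\<in>UNIV. f (i, k))"
  for f :: "'a::finite \<times> 'b::finite \<Rightarrow> 'c::comm_monoid_add"
  by (simp add: sum.cartesian_product flip: UNIV_Times_UNIV)

lemma adj_tensor_one: "adj (tensor_one X) = tensor_one (adj X)"
  by (auto simp: adj_def tensor_one_def vec_eq_iff)

lemma tensor_one_mult: "tensor_one X ** tensor_one Z = tensor_one (X ** Z)"
  by (simp add: tensor_one_def matrix_matrix_mult_def vec_eq_iff sum_prod_UNIV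
    if_distrib[where f = "\<lambda>x. x * _"] cong: if_cong)

lemma tensor_one_mat: "tensor_one (mat 1) = mat 1"
  by (simp add: tensor_one_def mat_def vec_eq_iff prod_eq_iff)

lemma unitary_tensor_one: "unitary_mat X \<Longrightarrow> unitary_mat (tensor_one X)"
  by (simp add: unitary_mat_def adj_tensor_one tensor_one_mult tensor_one_mat)

lemma tensor_id_entry: "tensor_id E R $ p $ q = E (\<chi> i j. R $ (i, snd p) $ (j, snd q)) $ fst p $ fst q"
proof -
  have "tensor_id E R $ p $ q = (\<Sum>k\<in>UNIV. \<Sum>l\<in>UNIV. if snd p = k then
      (if snd q = l then E (\<chi> i j. R $ (i, k) $ (j, l)) $ fst p $ fst q else 0) else 0)"
    unfolding tensor_id_def by (auto intro!: sum.cong)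
  also have "\<dots> = (\<Sum>k\<in>UNIV. if snd p = k then
      (\<Sum>l\<in>UNIV. if snd q = l then E (\<chi> i j. R $ (i, k) $ (j, l)) $ fst p $ fst q else 0) else 0)"
    by (rule sum.cong) auto
  finally show ?thesis by simp
qed

lemma tensor_id_unitary_channel:
  "tensor_id (unitary_channel X) R = tensor_one X ** R ** adj (tensor_one X)"
  by (simp add: vec_eq_iff tensor_id_entry adj_tensor_one)
    (simp add: unitary_channel_def tensor_one_def matrix_matrix_mult_def sum_prod_UNIV
      if_distrib[where f = "\<lambda>x. x * _"] if_distrib[where f = "\<lambda>x. _ * x"] cong: if_cong)

lemma tensor_id_id: "tensor_id id R = R"
  by (simp add: vec_eq_iff tensor_id_entry)

text \<open>X \<otimes> 1 acts on every slice of a separately, so a half-plane bound for the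
  quadratic form of X passes to X \<otimes> 1 with the same constant.\<close>

lemma cip_tensor_one:
  "cip a (tensor_one X *v a) = (\<Sum>k\<in>UNIV. cip (\<chi> i. a $ (i, k)) (X *v (\<chi> i. a $ (i, k))))"
proof -
  have "cip a (tensor_one X *v a)
      = (\<Sum>i\<in>UNIV. \<Sum>k\<in>UNIV. cnj (a $ (i, k)) * (\<Sum>j\<in>UNIV. X $ i $ j * a $ (j, k)))"
    by (simp add: cip_def tensor_one_def matrix_vector_mult_def sum_prod_UNIV
      if_distrib[where f = "\<lambda>x. x * _"] cong: if_cong)
  also have "\<dots> = (\<Sum>k\<in>UNIV. \<Sum>i\<in>UNIV. cnj (a $ (i, k)) * (\<Sum>j\<in>UNIV. X $ i $ j * a $ (j, k)))"
    by (rule sum.swap)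
  finally show ?thesis by (simp add: cip_def matrix_vector_mult_def)
qed

lemma norm_slices: "(norm a)\<^sup>2 = (\<Sum>k\<in>UNIV. (norm (\<chi> i. a $ (i, k)))\<^sup>2)"
  for a :: "complex^('d::finite \<times> 'd)"
proof -
  have "(norm a)\<^sup>2 = (\<Sum>i\<in>UNIV. \<Sum>k\<in>UNIV. (cmod (a $ (i, k)))\<^sup>2)"
    by (simp add: norm_vec_complex_sq sum_prod_UNIV)
  also have "\<dots> = (\<Sum>k\<in>UNIV. \<Sum>i\<in>UNIV. (cmod (a $ (i, k)))\<^sup>2)" by (rule sum.swap)
  finally show ?thesis by (simp add: norm_vec_complex_sq)
qed

text \<open>Serves as the witness that the supremum in \<open>diamond_dist\<close> ranges over a
  nonempty set.\<close>

lemma density_op_maximally_mixed: "density_op (mat (1 / of_nat CARD('n)) :: complex^'n::finite^'n)"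
proof -
  have "mat (1 / of_nat CARD('n)) *v v = (complex_of_real (1 / real CARD('n))) *s v" for v :: "complex^'n"
    by (simp add: mat_def matrix_vector_mult_def vec_eq_iff if_distrib[where f = "\<lambda>x. x * _"] cong: if_cong)
  then have "qform (mat (1 / of_nat CARD('n))) v = complex_of_real (1 / real CARD('n) * (norm v)\<^sup>2)"
    for v :: "complex^'n"
    by (simp only: qform_cip cip_scale_right cip_self of_real_mult)
  then show ?thesis
    by (auto simp: density_op_def adj_def mat_def vec_eq_iff trace_def)
qed

text \<open>The hypothesis \<open>num\<close> is linear in the quadratic form and can therefore be
  summed over slices. Allowing \<open>cmod w \<le> 1\<close> admits w = 0 with B = 0, which gives
  the trivial bound 1.\<close>

theorem diamond_dist_unitary_le:
  fixes X :: "complex^'d::finite^'d"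
  assumes X: "unitary_mat X" and B: "0 \<le> B" and w: "cmod w \<le> 1"
    and num: "\<And>v. B * (norm v)\<^sup>2 \<le> Re (w * cip v (X *v v))"
  shows "diamond_dist (unitary_channel X) id \<le> sqrt (1 - B\<^sup>2)"
proof -
  have *: "B * (norm a)\<^sup>2 \<le> cmod (cip a (tensor_one X *v a))" for a :: "complex^('d \<times> 'd)"
  proof -
    have "B * (norm a)\<^sup>2 \<le> Re (w * cip a (tensor_one X *v a))"
      unfolding norm_slices cip_tensor_one sum_distrib_left Re_sum by (intro sum_mono num)
    also have "\<dots> \<le> cmod w * cmod (cip a (tensor_one X *v a))"
      by (metis complex_Re_le_cmod norm_mult)
    also have "\<dots> \<le> cmod (cip a (tensor_one X *v a))"
      using w by (simp add: mult_left_le_one_le)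
    finally show ?thesis .
  qed
  have "(SUP rho \<in> {rho. density_op rho}.
      trace_norm (tensor_id (unitary_channel X) rho - tensor_id id rho)) \<le> 2 * sqrt (1 - B\<^sup>2)"
    using density_op_maximally_mixed[where 'n = "'d \<times> 'd"]
    by (intro cSUP_least)
      (auto simp: tensor_id_unitary_channel tensor_id_id
        intro!: trace_norm_conj_diff_le unitary_tensor_one X B *)
  then show ?thesis unfolding diamond_dist_def by linarith
qed

text \<open>A half-plane is convex, so it contains the numerical range as soon as it contains the
  eigenvalues.\<close>

lemma diamond_dist_spectral_le:
  assumes V: "unitary_mat V" and X: "unitary_mat X" "X = V ** diagm l ** adj V"
    and B: "0 \<le> B" and w: "cmod w \<le> 1" and l: "\<And>i. B \<le> Re (w * l i)"
  shows "diamond_dist (unitary_channel X) id \<le> sqrt (1 - B\<^sup>2)"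
proof (rule diamond_dist_unitary_le[OF X(1) B w])
  fix v
  let ?u = "adj V *v v"
  have nu: "norm ?u = norm v"
    using V by (intro norm_unitary_mult) (simp add: unitary_mat_def)
  have "cip v (X *v v) = (\<Sum>i\<in>UNIV. l i * complex_of_real ((cmod (?u $ i))\<^sup>2))"
    unfolding X(2) by (rule cip_spectral)
  then have "Re (w * cip v (X *v v)) = (\<Sum>i\<in>UNIV. Re (w * l i) * (cmod (?u $ i))\<^sup>2)"
    by (simp only: sum_distrib_left mult.assoc[symmetric] Re_sum) simp
  moreover have "B * (norm v)\<^sup>2 = (\<Sum>i\<in>UNIV. B * (cmod (?u $ i))\<^sup>2)"
    by (simp only: nu[symmetric] norm_vec_complex_sq sum_distrib_left)
  ultimately show "B * (norm v)\<^sup>2 \<le> Re (w * cip v (X *v v))"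
    by (simp del: times_complex.sel add: sum_mono mult_right_mono l)
qed

section \<open>Uniform average over the unit sphere\<close>

lemma measure_ball_pos: "0 < measure lborel (ball (0::'a::euclidean_space) 1)"
  using content_ball_pos[of 1 "0::'a"] by simp

section \<open>Invariance of Lebesgue measure under linear isometries\<close>

lemma nn_integral_lborel_shift:
  assumes [measurable]: "h \<in> borel_measurable borel"
  shows "(\<integral>\<^sup>+u. h (u + c) \<partial>lborel) = (\<integral>\<^sup>+u. h u \<partial>(lborel :: 'a::euclidean_space measure))"
proof -
  have "(\<integral>\<^sup>+u. h u \<partial>lborel) = (\<integral>\<^sup>+u. h u \<partial>distr lborel borel ((+) c))"
    by (simp add: lborel_distr_plus)
  also have "\<dots> = (\<integral>\<^sup>+u. h (c + u) \<partial>lborel)" by (subst nn_integral_distr) auto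
  finally show ?thesis by (simp add: add.commute)
qed

text \<open>Uniqueness of Haar measure in disguise: Fubini and translation invariance give
  \<open>(\<integral>f) (\<integral>g \<circ> T) = (\<integral>g) (\<integral>f \<circ> (- T))\<close>, applied to the indicator function \<open>f\<close> of the unit ball.\<close>
lemma nn_integral_lborel_isometry:
  fixes T :: "'a::euclidean_space \<Rightarrow> 'a"
  assumes T: "linear T" "\<And>x. norm (T x) = norm x" and g[measurable]: "g \<in> borel_measurable borel"
  shows "(\<integral>\<^sup>+u. g (T u) \<partial>lborel) = (\<integral>\<^sup>+u. g u \<partial>lborel)"
proof -
  have Tm[measurable]: "T \<in> borel_measurable borel"
    using T(1) by (intro borel_measurable_continuous_onI linear_continuous_on linear_conv_bounded_linear[THEN iffD1])
  have "inj T"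
    using T by (metis linear_injective_0 norm_eq_zero)
  then have "surj T" using T(1) linear_injective_imp_surjective by blast
  then have shift: "(\<integral>\<^sup>+u. h (T u + x) \<partial>lborel) = (\<integral>\<^sup>+u. h (T u) \<partial>lborel)"
    if [measurable]: "h \<in> borel_measurable borel" for h :: "'a \<Rightarrow> ennreal" and x
  proof -
    \<comment> \<open>As T is onto, a shift of its values is a shift of its argument, under which
      Lebesgue measure is invariant.\<close>
    obtain z where "x = T z" using \<open>surj T\<close> by (metis surjD)
    then have "(\<integral>\<^sup>+u. h (T u + x) \<partial>lborel) = (\<integral>\<^sup>+u. h (T (u + z)) \<partial>lborel)"
      using T(1) by (simp add: linear_add)
    then show ?thesis using nn_integral_lborel_shift[of "\<lambda>u. h (T u)" z] by simp
  qed
  define f :: "'a \<Rightarrow> ennreal" where "f = indicator (ball 0 1)"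
  have f[measurable]: "f \<in> borel_measurable borel"
    unfolding f_def by (rule borel_measurable_indicator) simp
  interpret lborel_pair: pair_sigma_finite "lborel :: 'a measure" "lborel :: 'a measure" ..
  have "(\<integral>\<^sup>+x. f x \<partial>lborel) * (\<integral>\<^sup>+u. g (T u) \<partial>lborel) = (\<integral>\<^sup>+x. f x * (\<integral>\<^sup>+u. g (T u) \<partial>lborel) \<partial>lborel)"
    by (rule nn_integral_multc[symmetric]) simp
  also have "\<dots> = (\<integral>\<^sup>+x. (\<integral>\<^sup>+u. f x * g (T u + x) \<partial>lborel) \<partial>lborel)"
    by (simp add: nn_integral_cmult shift[OF g])
  also have "\<dots> = (\<integral>\<^sup>+u. (\<integral>\<^sup>+x. f x * g (T u + x) \<partial>lborel) \<partial>lborel)"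
    by (rule lborel_pair.Fubini') measurable
  also have "\<dots> = (\<integral>\<^sup>+u. (\<integral>\<^sup>+x. f (x - T u) * g x \<partial>lborel) \<partial>lborel)"
  proof (rule nn_integral_cong)
    fix u
    have "(\<integral>\<^sup>+x. f (x - T u) * g x \<partial>lborel) = (\<integral>\<^sup>+x. f (x + T u - T u) * g (x + T u) \<partial>lborel)"
      by (rule nn_integral_lborel_shift[symmetric]) measurable
    then show "(\<integral>\<^sup>+x. f x * g (T u + x) \<partial>lborel) = (\<integral>\<^sup>+x. f (x - T u) * g x \<partial>lborel)"
      by (simp add: add.commute)
  qed
  also have "\<dots> = (\<integral>\<^sup>+x. (\<integral>\<^sup>+u. f (x - T u) * g x \<partial>lborel) \<partial>lborel)"
    by (rule lborel_pair.Fubini') measurable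
  also have "\<dots> = (\<integral>\<^sup>+x. (\<integral>\<^sup>+u. f (x - T u) \<partial>lborel) * g x \<partial>lborel)"
    by (intro nn_integral_cong nn_integral_multc) measurable
  also have "\<dots> = (\<integral>\<^sup>+x. (\<integral>\<^sup>+u. f u \<partial>lborel) * g x \<partial>lborel)"
  proof (rule nn_integral_cong)
    fix x
    have "(\<integral>\<^sup>+u. f (x - T u) \<partial>lborel) = (\<integral>\<^sup>+u. f (- (T u + (- x))) \<partial>lborel)" by simp
    also have "\<dots> = (\<integral>\<^sup>+u. f (- T u) \<partial>lborel)" by (rule shift) measurable
    \<comment> \<open>The indicator of the ball depends on the norm only, which neither T nor the
      sign changes.\<close>
    also have "\<dots> = (\<integral>\<^sup>+u. f u \<partial>lborel)" by (simp add: f_def indicator_def T(2))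
    finally show "(\<integral>\<^sup>+u. f (x - T u) \<partial>lborel) * g x = (\<integral>\<^sup>+u. f u \<partial>lborel) * g x" by simp
  qed
  also have "\<dots> = (\<integral>\<^sup>+x. f x \<partial>lborel) * (\<integral>\<^sup>+u. g u \<partial>lborel)"
    by (rule nn_integral_cmult) simp
  finally have *: "(\<integral>\<^sup>+x. f x \<partial>lborel) * (\<integral>\<^sup>+u. g (T u) \<partial>lborel) = (\<integral>\<^sup>+x. f x \<partial>lborel) * (\<integral>\<^sup>+u. g u \<partial>lborel)" .
  have fb: "(\<integral>\<^sup>+x. f x \<partial>lborel) = emeasure lborel (ball (0::'a) 1)"
    unfolding f_def by simp
  \<comment> \<open>The ball has positive finite measure, so its factor can be cancelled in
    \<open>ennreal\<close>.\<close>
  have "emeasure lborel (ball (0::'a) 1) \<noteq> 0" "emeasure lborel (ball (0::'a) 1) \<noteq> top"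
    using emeasure_lborel_ball_finite[of "0::'a" 1] measure_ball_pos[where 'a = 'a]
    by (auto simp: measure_def)
  then show ?thesis using * unfolding fb by (simp add: ennreal_mult_cancel_left)
qed

lemma lborel_distr_isometry:
  fixes T :: "'a::euclidean_space \<Rightarrow> 'a"
  assumes "linear T" "\<And>x. norm (T x) = norm x"
  shows "distr lborel borel T = lborel"
proof (rule measure_eqI)
  have [measurable]: "T \<in> borel_measurable borel"
    using assms(1) by (intro borel_measurable_continuous_onI linear_continuous_on linear_conv_bounded_linear[THEN iffD1])
  fix A assume "A \<in> sets (distr lborel borel T)"
  then have [measurable]: "A \<in> sets borel" by simp
  have "emeasure (distr lborel borel T) A = (\<integral>\<^sup>+u. indicator A u \<partial>distr lborel borel T)"
    by simp
  also have "\<dots> = (\<integral>\<^sup>+u. indicator A (T u) \<partial>lborel)"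
    by (rule nn_integral_distr) measurable
  also have "\<dots> = (\<integral>\<^sup>+u. indicator A u \<partial>lborel)"
    by (rule nn_integral_lborel_isometry[OF assms]) measurable
  finally show "emeasure (distr lborel borel T) A = emeasure lborel A" by simp
qed simp

section \<open>The average over the sphere as a linear, isometry-invariant functional\<close>

lemma radial_projection_measurable:
  fixes f :: "'a::euclidean_space \<Rightarrow> real"
  assumes "continuous_on UNIV f"
  shows "(\<lambda>x. f (x /\<^sub>R norm x)) \<in> borel_measurable borel"
proof -
  have [measurable]: "f \<in> borel_measurable borel" by (rule borel_measurable_continuous_onI[OF assms])
  show ?thesis by measurable
qed

lemma radial_projection_integrable:
  fixes f :: "'a::euclidean_space \<Rightarrow> real"
  assumes "continuous_on UNIV f"
  shows "set_integrable lborel (ball 0 1) (\<lambda>x. f (x /\<^sub>R norm x))"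
proof -
  \<comment> \<open>The closed ball rather than the sphere, because the radial projection as encoded
    sends the origin to 0.\<close>
  have "compact (f ` cball 0 1)"
    using assms by (intro compact_continuous_image) (auto intro: continuous_on_subset)
  then obtain b where "\<And>x. norm x \<le> 1 \<Longrightarrow> norm (f x) \<le> b"
    by (meson bounded_iff compact_imp_bounded image_eqI mem_cball_0)
  then have b: "norm (f (x /\<^sub>R norm x)) \<le> b" for x
    by (cases "x = 0") auto
  have m: "(\<lambda>x. f (x /\<^sub>R norm x)) \<in> borel_measurable borel"
    by (rule radial_projection_measurable[OF assms])
  show ?thesis
    unfolding set_integrable_def
    by (rule integrableI_bounded_set_indicator[where B = b])
      (use b m emeasure_lborel_ball_finite[of "0::'a" 1] in auto)
qed


lemma haar_avg_add:
  assumes "continuous_on UNIV f" "continuous_on UNIV g"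
  shows "haar_avg (\<lambda>x. f x + g x) = haar_avg f + haar_avg g"
  unfolding haar_avg_def
  by (simp add: set_integral_add radial_projection_integrable assms add_divide_distrib)

lemma haar_avg_cmult: "haar_avg (\<lambda>x. c * f x) = c * haar_avg f"
  unfolding haar_avg_def by simp

lemma haar_avg_const: "haar_avg (\<lambda>x::complex^'d::finite. c) = c"
  unfolding haar_avg_def using measure_ball_pos[where 'a = "complex^'d"]
  by (simp add: set_lebesgue_integral_def)

lemma haar_avg_sum:
  assumes "\<And>i. i \<in> I \<Longrightarrow> continuous_on UNIV (f i)"
  shows "haar_avg (\<lambda>x::complex^'d::finite. \<Sum>i\<in>I. f i x) = (\<Sum>i\<in>I. haar_avg (f i))"
  using assms
proof (induction I rule: infinite_finite_induct)
  case (insert i I)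
  then show ?case by (simp add: haar_avg_add continuous_on_sum)
qed (simp_all add: haar_avg_const)

text \<open>The radial projection misses the sphere only at the origin, a null set, so agreement on
  unit vectors is enough.\<close>

lemma haar_avg_cong:
  fixes f g :: "complex^'d::finite \<Rightarrow> real"
  assumes f: "continuous_on UNIV f" and g: "continuous_on UNIV g"
    and eq: "\<And>x. norm x = 1 \<Longrightarrow> f x = g x"
  shows "haar_avg f = haar_avg g"
proof -
  have "(LINT x : ball 0 1 | lborel. f (x /\<^sub>R norm x)) = (LINT x : ball 0 1 | lborel. g (x /\<^sub>R norm x))"
    unfolding set_lebesgue_integral_def
  proof (rule integral_cong_AE)
    show "AE x in lborel. indicator (ball 0 1) x *\<^sub>R f (x /\<^sub>R norm x) = indicator (ball 0 1) x *\<^sub>R g (x /\<^sub>R norm x)"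
      using AE_lborel_singleton[of 0] by eventually_elim (simp add: eq)
  qed (use radial_projection_integrable[OF f] radial_projection_integrable[OF g] in
      \<open>auto simp: set_integrable_def\<close>)
  then show ?thesis by (simp add: haar_avg_def)
qed

lemma haar_avg_nonneg:
  assumes "\<And>x. 0 \<le> f x"
  shows "0 \<le> haar_avg f"
  unfolding haar_avg_def set_lebesgue_integral_def
  by (intro divide_nonneg_nonneg integral_nonneg_AE AE_I2) (auto simp: assms)

text \<open>A linear isometry preserves Lebesgue measure and the ball, and commutes with the radial
  projection.\<close>

lemma haar_avg_isometry:
  fixes T :: "complex^'d::finite \<Rightarrow> complex^'d"
  assumes T: "linear T" "\<And>x. norm (T x) = norm x" and f: "continuous_on UNIV f"
  shows "haar_avg (\<lambda>x. f (T x)) = haar_avg f"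
proof -
  have Tm[measurable]: "T \<in> borel_measurable borel"
    using T(1) by (intro borel_measurable_continuous_onI linear_continuous_on linear_conv_bounded_linear[THEN iffD1])
  note [measurable] = radial_projection_measurable[OF f]
  let ?h = "\<lambda>x. indicator (ball 0 1) x *\<^sub>R f (x /\<^sub>R norm x)"
  have "integral\<^sup>L lborel ?h = integral\<^sup>L (distr lborel borel T) ?h"
    by (simp add: lborel_distr_isometry[OF T])
  also have "\<dots> = (\<integral>x. ?h (T x) \<partial>lborel)"
    by (rule integral_distr)
      (use radial_projection_integrable[OF f] in \<open>auto simp: set_integrable_def\<close>)
  also have "\<dots> = (\<integral>x. indicator (ball 0 1) x *\<^sub>R f (T (x /\<^sub>R norm x)) \<partial>lborel)"
    by (rule Bochner_Integration.integral_cong) (auto simp: T(2) linear_cmul[OF T(1)] indicator_def)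
  finally show ?thesis by (simp add: haar_avg_def set_lebesgue_integral_def)
qed

lemma haar_avg_swap:
  fixes f :: "complex^'d::finite \<Rightarrow> real"
  assumes "continuous_on UNIV f"
  shows "haar_avg (\<lambda>x. f (\<chi> k. x $ (Transposition.transpose i j k))) = haar_avg f"
proof (rule haar_avg_isometry[OF _ _ assms])
  show "linear (\<lambda>x :: complex^'d. \<chi> k. x $ (Transposition.transpose i j k))"
    by (rule linearI) (simp_all add: vec_eq_iff)
  fix x :: "complex^'d"
  have "(\<Sum>k\<in>UNIV. (cmod (x $ Transposition.transpose i j k))\<^sup>2) = (\<Sum>k\<in>UNIV. (cmod (x $ k))\<^sup>2)"
    by (rule sum.reindex_bij_betw) simp
  then have "(norm (\<chi> k. x $ Transposition.transpose i j k))\<^sup>2 = (norm x)\<^sup>2"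
    by (simp add: norm_vec_complex_sq)
  then show "norm (\<chi> k. x $ Transposition.transpose i j k) = norm x"
    by simp
qed

section \<open>Moments of the squared moduli of the coordinates\<close>

abbreviation (input) absq :: "complex^'d::finite \<Rightarrow> 'd \<Rightarrow> real" where
  "absq x i \<equiv> (cmod (x $ i))\<^sup>2"

lemma parallelogram_complex:
  assumes "cmod w = 1"
  shows "(cmod (a + w * b))\<^sup>2 + (cmod (b - cnj w * a))\<^sup>2 = 2 * ((cmod a)\<^sup>2 + (cmod b)\<^sup>2)"
proof -
  have w: "Re w * Re w + Im w * Im w = 1"
    using assms by (metis cmod_power2 one_power2 power2_eq_square)
  have "(cmod (a + w * b))\<^sup>2 + (cmod (b - cnj w * a))\<^sup>2
      = (1 + (Re w * Re w + Im w * Im w)) * ((cmod a)\<^sup>2 + (cmod b)\<^sup>2)"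
    by (simp add: cmod_power2) algebra
  then show ?thesis by (simp add: w)
qed

lemma sum_UNIV_split_two:
  fixes h :: "'d::finite \<Rightarrow> 'a::comm_monoid_add"
  assumes "i \<noteq> j"
  shows "(\<Sum>k\<in>UNIV. h k) = h i + h j + (\<Sum>k\<in>UNIV - {i, j}. h k)"
  using assms by (simp add: sum.remove[of UNIV i] sum.remove[of "UNIV - {i}" j] insert_commute
      Diff_insert2[symmetric] add.assoc flip: Diff_insert)

text \<open>A unitary 2 x 2 block mixes x_i and x_j and leaves the other coordinates alone, on which
  g depends exclusively. The normalisation 1 / sqrt 2 of the block produces the factor
  \<open>2 ^ n\<close>.\<close>

lemma haar_avg_rotate:
  fixes g :: "complex^'d::finite \<Rightarrow> real"
  assumes g: "continuous_on UNIV g" "\<And>x y. (\<And>k. k \<noteq> i \<Longrightarrow> k \<noteq> j \<Longrightarrow> x $ k = y $ k) \<Longrightarrow> g x = g y"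
    and ij: "i \<noteq> j" and w: "cmod w = 1"
  shows "haar_avg (\<lambda>x. g x * ((cmod (x $ i + w * x $ j))\<^sup>2) ^ n) = 2 ^ n * haar_avg (\<lambda>x. g x * absq x i ^ n)"
proof -
  let ?s = "complex_of_real (1 / sqrt 2)"
  let ?T = "\<lambda>x. \<chi> k. if k = i then ?s * (x $ i + w * x $ j)
      else if k = j then ?s * (x $ j - cnj w * x $ i) else x $ k"
  have s2: "(cmod (z / complex_of_real (sqrt 2)))\<^sup>2 = (cmod z)\<^sup>2 / 2" for z
    by (simp add: norm_divide power_divide)
  have lin: "linear ?T"
    by (rule linearI)
      (simp_all add: vec_eq_iff algebra_simps add_divide_distrib diff_divide_distrib
        scaleR_conv_of_real[where 'a = complex])
  have sum_ij: "(\<Sum>k\<in>UNIV. h k) = h i + h j + (\<Sum>k\<in>UNIV - {i, j}. h k)" for h :: "'d \<Rightarrow> real"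
    by (rule sum_UNIV_split_two[OF ij])
  have iso: "norm (?T x) = norm x" for x
  proof -
    have "(norm (?T x))\<^sup>2 = (norm x)\<^sup>2"
      unfolding norm_vec_complex_sq sum_ij
      using ij parallelogram_complex[OF w, of "x $ i" "x $ j"] by (simp add: s2 add_divide_distrib[symmetric])
    then show ?thesis by simp
  qed
  have "haar_avg (\<lambda>x. g x * absq x i ^ n) = haar_avg (\<lambda>x. g (?T x) * absq (?T x) i ^ n)"
    by (rule haar_avg_isometry[OF lin iso, symmetric]) (intro continuous_intros g(1))
  also have "\<dots> = haar_avg (\<lambda>x. (1/2^n) * (g x * ((cmod (x $ i + w * x $ j))\<^sup>2) ^ n))"
  proof (rule arg_cong[where f = haar_avg], rule ext)
    fix x
    have "g (?T x) = g x" by (rule g(2)) simp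
    then show "g (?T x) * absq (?T x) i ^ n = (1/2^n) * (g x * ((cmod (x $ i + w * x $ j))\<^sup>2) ^ n)"
      using ij by (simp add: s2 power_divide)
  qed
  finally show ?thesis unfolding haar_avg_cmult by simp
qed

lemma cmod_add_phase_sq:
  assumes "cmod w = 1"
  shows "(cmod (a + w * b))\<^sup>2 = (cmod a)\<^sup>2 + (cmod b)\<^sup>2 + 2 * Re (w * (cnj a * b))"
proof -
  have w: "Re w * Re w + Im w * Im w = 1"
    using assms by (metis cmod_power2 one_power2 power2_eq_square)
  have "(cmod (a + w * b))\<^sup>2 = (cmod a)\<^sup>2 + (Re w * Re w + Im w * Im w) * (cmod b)\<^sup>2 + 2 * Re (w * (cnj a * b))"
    by (simp add: cmod_power2) algebra
  then show ?thesis by (simp add: w)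
qed

text \<open>As a polynomial in w and its inverse, |a + w b|^(2n) has exponents of absolute value at
  most n. Summing over the eighth roots of unity kills every exponent not divisible by 8, so for n
  \<le> 4 only the phase-free term survives.\<close>

definition eighth_roots :: "complex list" where
  "eighth_roots = [1, -1, \<i>, -\<i>, Complex (1/sqrt 2) (1/sqrt 2), Complex (-1/sqrt 2) (-1/sqrt 2),
     Complex (1/sqrt 2) (-1/sqrt 2), Complex (-1/sqrt 2) (1/sqrt 2)]"

lemma cmod_eighth_roots: "w \<in> set eighth_roots \<Longrightarrow> cmod w = 1"
  by (auto simp: eighth_roots_def cmod_def power_divide)

text \<open>The phase-free term of |a + w b|^(2n) is the sum of (n choose k)^2 A^(n-k) B^k; the
  coefficients are eight times these squares.\<close>

lemma phase_sum:
  fixes a b :: complex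
  defines "A \<equiv> (cmod a)\<^sup>2" and "B \<equiv> (cmod b)\<^sup>2"
  shows "(\<Sum>w\<leftarrow>eighth_roots. ((cmod (a + w * b))\<^sup>2) ^ 2) = 8 * A^2 + 32 * A * B + 8 * B^2"
    and "(\<Sum>w\<leftarrow>eighth_roots. ((cmod (a + w * b))\<^sup>2) ^ 3) = 8 * A^3 + 72 * A^2 * B + 72 * A * B^2 + 8 * B^3"
    and "(\<Sum>w\<leftarrow>eighth_roots. ((cmod (a + w * b))\<^sup>2) ^ 4)
      = 8 * A^4 + 128 * A^3 * B + 288 * A^2 * B^2 + 128 * A * B^3 + 8 * B^4"
proof -
  \<comment> \<open>The phases act on \<open>cnj a * b\<close> = p + i q only; A B = p^2 + q^2 and 2
    r^2 = 1 are all the relations behind the three identities.\<close>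
  define p q r where "p = Re (cnj a * b)" and "q = Im (cnj a * b)" and "r = 1 / sqrt 2"
  have AB: "A * B = p\<^sup>2 + q\<^sup>2"
    by (simp add: A_def B_def p_def q_def cmod_power2) algebra
  have r: "2 * r\<^sup>2 = 1" by (simp add: r_def power_divide)
  have e: "(\<Sum>w\<leftarrow>eighth_roots. ((cmod (a + w * b))\<^sup>2) ^ n)
    = (A + B + 2 * p) ^ n + (A + B - 2 * p) ^ n + (A + B - 2 * q) ^ n + (A + B + 2 * q) ^ n
    + (A + B + 2 * (r * (p - q))) ^ n + (A + B - 2 * (r * (p - q))) ^ n
    + (A + B + 2 * (r * (p + q))) ^ n + (A + B - 2 * (r * (p + q))) ^ n" for n
  proof -
    have "(\<Sum>w\<leftarrow>eighth_roots. ((cmod (a + w * b))\<^sup>2) ^ n)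
        = (\<Sum>w\<leftarrow>eighth_roots. (A + B + 2 * (Re w * p - Im w * q)) ^ n)"
      by (rule arg_cong[where f = sum_list], rule map_cong)
        (simp_all add: cmod_eighth_roots cmod_add_phase_sq A_def B_def p_def q_def)
    also have "\<dots> = (A + B + 2 * p) ^ n + (A + B - 2 * p) ^ n + (A + B - 2 * q) ^ n + (A + B + 2 * q) ^ n
    + (A + B + 2 * (r * (p - q))) ^ n + (A + B - 2 * (r * (p - q))) ^ n
    + (A + B + 2 * (r * (p + q))) ^ n + (A + B - 2 * (r * (p + q))) ^ n"
      by (simp add: eighth_roots_def r_def add_divide_distrib diff_divide_distrib algebra_simps)
    finally show ?thesis .
  qed
  show "(\<Sum>w\<leftarrow>eighth_roots. ((cmod (a + w * b))\<^sup>2) ^ 2) = 8 * A^2 + 32 * A * B + 8 * B^2"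
    unfolding e using AB r by algebra
  show "(\<Sum>w\<leftarrow>eighth_roots. ((cmod (a + w * b))\<^sup>2) ^ 3) = 8 * A^3 + 72 * A^2 * B + 72 * A * B^2 + 8 * B^3"
    unfolding e using AB r by algebra
  show "(\<Sum>w\<leftarrow>eighth_roots. ((cmod (a + w * b))\<^sup>2) ^ 4)
      = 8 * A^4 + 128 * A^3 * B + 288 * A^2 * B^2 + 128 * A * B^3 + 8 * B^4"
    unfolding e using AB r by algebra
qed

lemma haar_avg_sum_list:
  assumes "\<And>w. w \<in> set ws \<Longrightarrow> continuous_on UNIV (f w)"
  shows "(\<Sum>w\<leftarrow>ws. haar_avg (f w)) = haar_avg (\<lambda>x::complex^'d::finite. \<Sum>w\<leftarrow>ws. f w x)"
  using assms
proof (induction ws)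
  case (Cons w ws)
  have "continuous_on UNIV (\<lambda>x. \<Sum>w\<leftarrow>ws. f w x)"
    using Cons.prems by (induction ws) (auto intro!: continuous_intros)
  then show ?case using Cons by (simp add: haar_avg_add)
qed (simp add: haar_avg_const)

lemma haar_avg_phase_sum:
  fixes g :: "complex^'d::finite \<Rightarrow> real"
  assumes g: "continuous_on UNIV g" "\<And>x y. (\<And>k. k \<noteq> i \<Longrightarrow> k \<noteq> j \<Longrightarrow> x $ k = y $ k) \<Longrightarrow> g x = g y"
    and ij: "i \<noteq> j"
  shows "haar_avg (\<lambda>x. g x * (\<Sum>w\<leftarrow>eighth_roots. ((cmod (x $ i + w * x $ j))\<^sup>2) ^ n))
    = 8 * 2 ^ n * haar_avg (\<lambda>x. g x * absq x i ^ n)"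
proof -
  have "haar_avg (\<lambda>x. g x * (\<Sum>w\<leftarrow>eighth_roots. ((cmod (x $ i + w * x $ j))\<^sup>2) ^ n))
      = (\<Sum>w\<leftarrow>eighth_roots. haar_avg (\<lambda>x. g x * ((cmod (x $ i + w * x $ j))\<^sup>2) ^ n))"
    by (subst haar_avg_sum_list) (auto intro!: continuous_intros g(1) simp: sum_list_const_mult)
  also have "\<dots> = (\<Sum>w\<leftarrow>eighth_roots. 2 ^ n * haar_avg (\<lambda>x. g x * absq x i ^ n))"
    by (rule arg_cong[where f = sum_list], rule map_cong[OF refl])
      (rule haar_avg_rotate[OF g ij cmod_eighth_roots])
  finally show ?thesis by (simp add: sum_list_triv eighth_roots_def)
qed

lemma haar_avg_exchange:
  fixes g :: "complex^'d::finite \<Rightarrow> real"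
  assumes g: "continuous_on UNIV g" "\<And>x y. (\<And>k. k \<noteq> i \<Longrightarrow> k \<noteq> j \<Longrightarrow> x $ k = y $ k) \<Longrightarrow> g x = g y"
    and ij: "i \<noteq> j"
  shows "haar_avg (\<lambda>x. g x * (absq x j ^ m * absq x i ^ n)) = haar_avg (\<lambda>x. g x * (absq x i ^ m * absq x j ^ n))"
proof -
  have *: "g (\<chi> k. x $ (Transposition.transpose i j k)) = g x" for x
    by (rule g(2)) simp
  have "continuous_on UNIV (\<lambda>x. g x * (absq x i ^ m * absq x j ^ n))"
    by (intro continuous_intros g(1))
  from haar_avg_swap[OF this, of i j] show ?thesis
    by (simp only: * vec_lambda_beta transpose_apply_first transpose_apply_second)
qed

text \<open>Invariance under \<open>x\<^sub>i \<mapsto> (x\<^sub>i + w x\<^sub>j) / sqrt 2\<close>, averaged over eight phases \<open>w\<close> to remove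
  the cross terms.\<close>
lemma haar_avg_reduce:
  fixes g :: "complex^'d::finite \<Rightarrow> real"
  assumes g: "continuous_on UNIV g" "\<And>x y. (\<And>k. k \<noteq> i \<Longrightarrow> k \<noteq> j \<Longrightarrow> x $ k = y $ k) \<Longrightarrow> g x = g y"
    and ij: "i \<noteq> j"
  shows "haar_avg (\<lambda>x. g x * absq x i ^ 2) = 2 * haar_avg (\<lambda>x. g x * (absq x i * absq x j))"
    and "haar_avg (\<lambda>x. g x * absq x i ^ 3) = 3 * haar_avg (\<lambda>x. g x * (absq x i ^ 2 * absq x j))"
    and "112 * haar_avg (\<lambda>x. g x * absq x i ^ 4) = 256 * haar_avg (\<lambda>x. g x * (absq x i ^ 3 * absq x j))
      + 288 * haar_avg (\<lambda>x. g x * (absq x i ^ 2 * absq x j ^ 2))"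
proof -
  define G where "G m n = (\<lambda>x. g x * (absq x i ^ m * absq x j ^ n))" for m n
  have ex: "haar_avg (G m n) = haar_avg (G n m)" for m n
    using haar_avg_exchange[OF g ij, of n m] by (simp add: G_def mult.commute)
  have cont: "continuous_on UNIV (G m n)" for m n
    unfolding G_def by (intro continuous_intros g(1))
  have lin: "haar_avg (\<lambda>x. \<Sum>(a, m, n)\<leftarrow>L. a * G m n x) = (\<Sum>(a, m, n)\<leftarrow>L. a * haar_avg (G m n))" for L
  proof -
    have "haar_avg (\<lambda>x. \<Sum>t\<leftarrow>L. fst t * G (fst (snd t)) (snd (snd t)) x)
        = (\<Sum>t\<leftarrow>L. haar_avg (\<lambda>x. fst t * G (fst (snd t)) (snd (snd t)) x))"
      by (rule haar_avg_sum_list[symmetric]) (intro continuous_on_mult_left cont)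
    then show ?thesis by (simp add: haar_avg_cmult case_prod_unfold)
  qed
  have *: "8 * 2 ^ n * haar_avg (G n 0) = (\<Sum>(a, m, n)\<leftarrow>L. a * haar_avg (G m n))"
    if "\<And>a b. (\<Sum>w\<leftarrow>eighth_roots. ((cmod (a + w * b))\<^sup>2) ^ n)
      = (\<Sum>(c, m, n)\<leftarrow>L. c * (((cmod a)\<^sup>2) ^ m * ((cmod b)\<^sup>2) ^ n))" for n L
  proof -
    have "8 * 2 ^ n * haar_avg (G n 0)
        = haar_avg (\<lambda>x. g x * (\<Sum>w\<leftarrow>eighth_roots. ((cmod (x $ i + w * x $ j))\<^sup>2) ^ n))"
      using haar_avg_phase_sum[OF g ij, of n] by (simp add: G_def)
    also have "\<dots> = haar_avg (\<lambda>x. \<Sum>(a, m, n)\<leftarrow>L. a * G m n x)"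
      unfolding that sum_list_const_mult[symmetric]
      by (simp add: G_def case_prod_unfold mult_ac)
    finally show ?thesis unfolding lin .
  qed
  \<comment> \<open>The factor on the left is 8 * 2^n: eight phases, and 2^n from the rotation.
    Monomials that differ by exchanging i and j have equal averages and are collected.\<close>
  have "32 * haar_avg (G 2 0) = 16 * haar_avg (G 2 0) + 32 * haar_avg (G 1 1)"
    using *[of 2 "[(8, 2, 0), (32, 1, 1), (8, 0, 2)]", unfolded phase_sum] ex[of 0 2] by simp
  then show "haar_avg (\<lambda>x. g x * absq x i ^ 2) = 2 * haar_avg (\<lambda>x. g x * (absq x i * absq x j))"
    by (simp add: G_def)
  have "64 * haar_avg (G 3 0) = 16 * haar_avg (G 3 0) + 144 * haar_avg (G 2 1)"
    using *[of 3 "[(8, 3, 0), (72, 2, 1), (72, 1, 2), (8, 0, 3)]", unfolded phase_sum] ex[of 0 3] ex[of 1 2]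
    by simp
  then show "haar_avg (\<lambda>x. g x * absq x i ^ 3) = 3 * haar_avg (\<lambda>x. g x * (absq x i ^ 2 * absq x j))"
    by (simp add: G_def)
  have "128 * haar_avg (G 4 0) = 16 * haar_avg (G 4 0) + 256 * haar_avg (G 3 1) + 288 * haar_avg (G 2 2)"
    using *[of 4 "[(8, 4, 0), (128, 3, 1), (288, 2, 2), (128, 1, 3), (8, 0, 4)]", unfolded phase_sum]
      ex[of 0 4] ex[of 1 3]
    by simp
  then show "112 * haar_avg (\<lambda>x. g x * absq x i ^ 4) = 256 * haar_avg (\<lambda>x. g x * (absq x i ^ 3 * absq x j))
      + 288 * haar_avg (\<lambda>x. g x * (absq x i ^ 2 * absq x j ^ 2))"
    by (simp add: G_def)
qed

definition moment2 :: "'d::finite \<Rightarrow> 'd \<Rightarrow> real" where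
  "moment2 i j = haar_avg (\<lambda>x. absq x i * absq x j)"

definition moment4 :: "'d::finite \<Rightarrow> 'd \<Rightarrow> 'd \<Rightarrow> 'd \<Rightarrow> real" where
  "moment4 i j k l = haar_avg (\<lambda>x. absq x i * absq x j * absq x k * absq x l)"

text \<open>Exchanging coordinates relates the diagonal moments to each other, the rotation relates
  them to the off-diagonal ones. The one remaining unknown is determined later by
  normalisation.\<close>

lemma moment2_eq:
  fixes a i j :: "'d::finite"
  shows "moment2 i j = moment2 a a / 2 * (1 + of_bool (i = j))"
proof -
  have 1: "moment2 i i = moment2 j j" for i j :: 'd
  proof (cases "i = j")
    case False
    have "haar_avg (\<lambda>x. 1 * (absq x j ^ 2 * absq x i ^ 0)) = haar_avg (\<lambda>x. 1 * (absq x i ^ 2 * absq x j ^ 0))"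
      by (rule haar_avg_exchange) (use False in auto)
    then show ?thesis by (simp add: moment2_def flip: power2_eq_square)
  qed simp
  have 2: "moment2 i i = 2 * moment2 i j" if "i \<noteq> j" for i j :: 'd
  proof -
    have "haar_avg (\<lambda>x. 1 * absq x i ^ 2) = 2 * haar_avg (\<lambda>x. 1 * (absq x i * absq x j))"
      by (rule haar_avg_reduce(1)) (use that in auto)
    then show ?thesis by (simp add: moment2_def flip: power2_eq_square)
  qed
  show ?thesis using 1[of i a] 2[of i j] by auto
qed

text \<open>The product of the three factors is \<open>m\<^sub>1! m\<^sub>2! \<dots>\<close> for the multiplicities \<open>m\<^sub>r\<close> of the values among
  \<open>i, j, k, l\<close>, written as in a Polya urn so that it can be summed one index at a time.\<close>
lemma moment4_eq:
  fixes a i j k l :: "'d::finite"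
  assumes d: "CARD('d) \<ge> 4"
  shows "moment4 i j k l = moment4 a a a a / 24 * ((1 + of_bool (i = j)) *
    (1 + of_bool (i = k) + of_bool (j = k)) * (1 + of_bool (i = l) + of_bool (j = l) + of_bool (k = l)))"
proof -
  have ex: "\<exists>k::'d. k \<notin> {i, j}" for i j
  proof -
    have "card {i, j} < CARD('d)" using d by (cases "i = j") auto
    then show ?thesis by (metis UNIV_I card_mono finite leD subsetI)
  qed
  have m4: "moment4 i i i i = moment4 j j j j" for i j :: 'd
  proof (cases "i = j")
    case False
    have "haar_avg (\<lambda>x. 1 * (absq x j ^ 4 * absq x i ^ 0)) = haar_avg (\<lambda>x. 1 * (absq x i ^ 4 * absq x j ^ 0))"
      by (rule haar_avg_exchange) (use False in auto)
    then show ?thesis by (simp only: moment4_def power4_eq_xxxx power_0 mult_1 mult_1_right mult.assoc)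
  qed simp
  have m31': "moment4 i i i j = 3 * moment4 i i j k" if "i \<noteq> j" "k \<notin> {i, j}" for i j k :: 'd
  proof -
    have "haar_avg (\<lambda>x. absq x j * absq x i ^ 3) = 3 * haar_avg (\<lambda>x. absq x j * (absq x i ^ 2 * absq x k))"
      by (rule haar_avg_reduce(2)) (use that in \<open>auto intro!: continuous_intros\<close>)
    then show ?thesis by (simp only: moment4_def power3_eq_cube power2_eq_square[of "absq _ i"] mult_ac)
  qed
  have m22': "moment4 i i j j = 2 * moment4 j j i k" if "i \<noteq> j" "k \<notin> {i, j}" for i j k :: 'd
  proof -
    have "haar_avg (\<lambda>x. (absq x j * absq x j) * absq x i ^ 2)
        = 2 * haar_avg (\<lambda>x. (absq x j * absq x j) * (absq x i * absq x k))"
      by (rule haar_avg_reduce(1)) (use that in \<open>auto intro!: continuous_intros\<close>)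
    then show ?thesis by (simp only: moment4_def power2_eq_square[of "absq _ i"] mult_ac)
  qed
  have m211': "moment4 i i j k = 2 * moment4 i j k l" if "distinct [i, j, k, l]" for i j k l :: 'd
  proof -
    have "haar_avg (\<lambda>x. (absq x j * absq x k) * absq x i ^ 2)
        = 2 * haar_avg (\<lambda>x. (absq x j * absq x k) * (absq x i * absq x l))"
      by (rule haar_avg_reduce(1)) (use that in \<open>auto intro!: continuous_intros\<close>)
    then show ?thesis by (simp only: moment4_def power2_eq_square[of "absq _ i"] mult_ac)
  qed
  have m4': "112 * moment4 i i i i = 256 * moment4 i i i j + 288 * moment4 i i j j" if "i \<noteq> j" for i j :: 'd
  proof -
    have "112 * haar_avg (\<lambda>x. 1 * absq x i ^ 4) = 256 * haar_avg (\<lambda>x. 1 * (absq x i ^ 3 * absq x j))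
      + 288 * haar_avg (\<lambda>x. 1 * (absq x i ^ 2 * absq x j ^ 2))"
      by (rule haar_avg_reduce(3)) (use that in auto)
    then show ?thesis
      by (simp only: moment4_def power4_eq_xxxx power3_eq_cube power2_eq_square[of "absq _ _"] mult_1 mult_ac)
  qed
  \<comment> \<open>Chosen as the common value of the moments with four distinct indices; 24 = 4! is
    the weight of four equal ones.\<close>
  define c where "c = moment4 a a a a / 24"
  have q: "moment4 i i i i = 24 * c" for i :: 'd using m4[of i a] by (simp add: c_def)
  \<comment> \<open>With t = \<open>moment4 i i j k\<close> the relations give 3 t for the pattern
    iiij and 2 t for iijj, so 112 * 24 c = (256 * 3 + 288 * 2) t, that is t = 2 c.\<close>
  have q31: "moment4 i i i j = 6 * c" and q22: "moment4 i i j j = 4 * c" if "i \<noteq> j" for i j :: 'd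
  proof -
    obtain k where k: "k \<notin> {i, j}" using ex by blast
    have "moment4 i i j j = moment4 j j i i" by (simp add: moment4_def mult_ac)
    then show "moment4 i i i j = 6 * c" "moment4 i i j j = 4 * c"
      using m31'[OF that k] m22'[of j i k] m4'[OF that] q[of i] that k by auto
  qed
  have q211: "moment4 i i j k = 2 * c" if "i \<noteq> j" "k \<notin> {i, j}" for i j k :: 'd
    using m31'[OF that] q31[OF that(1)] by simp
  have q1111: "moment4 i j k l = c" if "distinct [i, j, k, l]" for i j k l :: 'd
    using m211'[OF that] q211[of i j k] that by auto
  note ac = moment4_def mult_ac
  have p3: "moment4 j i i i = 6 * c" "moment4 i j i i = 6 * c" "moment4 i i j i = 6 * c" if "i \<noteq> j" for i j :: 'd
    using q31[OF that] by (simp_all only: ac)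
  have p2: "moment4 i j i j = 4 * c" "moment4 i j j i = 4 * c" if "i \<noteq> j" for i j :: 'd
    using q22[OF that] by (simp_all only: ac)
  have p1: "moment4 j i i k = 2 * c" "moment4 j k i i = 2 * c" "moment4 i j i k = 2 * c"
    "moment4 i j k i = 2 * c" "moment4 j i k i = 2 * c" if "i \<noteq> j" "k \<notin> {i, j}" for i j k :: 'd
    using q211[OF that] by (simp_all only: ac)
  show ?thesis
    unfolding c_def[symmetric]
    by (cases "i = j"; cases "i = k"; cases "j = k"; cases "i = l"; cases "j = l"; cases "k = l")
      (simp_all add: q q31 q22 q211 q1111 p3 p2 p1)
qed

section \<open>Second and fourth moments of weighted sums of the squared moduli\<close>

lemma sum_of_bool_eq: "(\<Sum>k\<in>UNIV. f k * of_bool (i = k)) = f i"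
  for f :: "'d::finite \<Rightarrow> 'a::semiring_1"
  by simp

lemma Re_mult_of_real: "Re (z * complex_of_real r) = Re z * r"
  by simp

lemma urn_sum2:
  fixes a b :: "'d::finite \<Rightarrow> complex"
  shows "(\<Sum>i\<in>UNIV. \<Sum>j\<in>UNIV. a i * b j * (1 + of_bool (i = j)))
    = (\<Sum>i\<in>UNIV. a i) * (\<Sum>j\<in>UNIV. b j) + (\<Sum>i\<in>UNIV. a i * b i)"
proof -
  have "(\<Sum>j\<in>UNIV. a i * b j * (1 + of_bool (i = j))) = a i * (\<Sum>j\<in>UNIV. b j) + a i * b i" for i
    by (simp add: distrib_left sum.distrib sum_distrib_left)
  then show ?thesis by (simp add: sum.distrib sum_distrib_right)
qed

text \<open>Meant for unit numbers \<open>a i\<close> with \<open>b i = cnj (a i)\<close>: the first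
  term is then |S^2 + S2|^2, the source of Q. Summing over the last index first is easy, since its
  urn factor merely adds the values at the earlier indices; \<open>a i * b i = 1\<close> then
  removes the mixed products.\<close>

lemma urn_sum4:
  fixes a b :: "'d::finite \<Rightarrow> complex"
  assumes ab: "\<And>i. a i * b i = 1"
  defines "S \<equiv> \<Sum>i\<in>UNIV. a i" and "S2 \<equiv> \<Sum>i\<in>UNIV. a i * a i"
    and "T \<equiv> \<Sum>i\<in>UNIV. b i" and "T2 \<equiv> \<Sum>i\<in>UNIV. b i * b i" and "d \<equiv> of_nat CARD('d)"
  shows "(\<Sum>i\<in>UNIV. \<Sum>j\<in>UNIV. \<Sum>k\<in>UNIV. \<Sum>l\<in>UNIV. a i * a j * b k * b l *
      ((1 + of_bool (i = j)) * (1 + of_bool (i = k) + of_bool (j = k))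
        * (1 + of_bool (i = l) + of_bool (j = l) + of_bool (k = l))))
    = (S * S + S2) * (T * T + T2) + 4 * (d + 2) * (S * T) + 2 * d * (d + 3)"
proof -
  note dist = distrib_left distrib_right sum.distrib
  have 1: "(\<Sum>l\<in>UNIV. b l * (1 + of_bool (i = l) + of_bool (j = l) + of_bool (k = l))) = T + b i + b j + b k"
    for i j k by (simp add: dist T_def)
  have 2: "(\<Sum>k\<in>UNIV. b k * (1 + of_bool (i = k) + of_bool (j = k)) * (T + b i + b j + b k))
      = T * T + T2 + 2 * T * b i + 2 * T * b j + 2 * (b i * b i) + 2 * (b j * b j) + 2 * (b i * b j)" for i j
  proof -
    have "(\<Sum>k\<in>UNIV. b k * (1 + of_bool (i = k) + of_bool (j = k)) * (T + b i + b j + b k))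
      = (\<Sum>k\<in>UNIV. b k) * (T + b i + b j) + (\<Sum>k\<in>UNIV. b k * b k)
        + (b i * (T + b i + b j + b i) + b j * (T + b i + b j + b j))"
    proof -
      have "b k * (1 + of_bool (i = k) + of_bool (j = k)) * (T + b i + b j + b k)
        = b k * (T + b i + b j) + b k * b k + (b k * (T + b i + b j + b k)) * of_bool (i = k)
          + (b k * (T + b i + b j + b k)) * of_bool (j = k)" for k
        by (simp add: algebra_simps)
      then show ?thesis by (simp only: sum.distrib sum_of_bool_eq sum_distrib_right add.assoc)
    qed
    then show ?thesis unfolding T_def[symmetric] T2_def[symmetric] by (simp add: algebra_simps)
  qed
  have 3: "(\<Sum>j\<in>UNIV. a j * (1 + of_bool (i = j)) *
      (T * T + T2 + 2 * T * b i + 2 * T * b j + 2 * (b i * b i) + 2 * (b j * b j) + 2 * (b i * b j)))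
    = S * (T * T + T2 + 2 * T * b i + 2 * (b i * b i)) + 2 * T * d + 2 * T + 2 * b i * d
      + a i * (T * T + T2) + 4 * T + 6 * b i" for i
  proof -
    have e: "a j * (T * T + T2 + 2 * T * b i + 2 * T * b j + 2 * (b i * b i) + 2 * (b j * b j) + 2 * (b i * b j))
      = a j * (T * T + T2 + 2 * T * b i + 2 * (b i * b i)) + 2 * T + 2 * b j + 2 * b i" for j
      using ab[of j] by algebra
    have "(\<Sum>j\<in>UNIV. a j * (1 + of_bool (i = j)) *
        (T * T + T2 + 2 * T * b i + 2 * T * b j + 2 * (b i * b i) + 2 * (b j * b j) + 2 * (b i * b j)))
      = (\<Sum>j\<in>UNIV. (1 + of_bool (i = j)) * (a j * (T * T + T2 + 2 * T * b i + 2 * (b i * b i)) + 2 * T + 2 * b j + 2 * b i))"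
      by (rule sum.cong[OF refl], subst e[symmetric], simp add: mult_ac)
    also have "\<dots> = (\<Sum>j\<in>UNIV. a j * (T * T + T2 + 2 * T * b i + 2 * (b i * b i)) + 2 * T + 2 * b j + 2 * b i)
       + (a i * (T * T + T2 + 2 * T * b i + 2 * (b i * b i)) + 2 * T + 2 * b i + 2 * b i)"
      by (simp add: distrib_right sum.distrib)
    also have "(\<Sum>j\<in>UNIV. a j * (T * T + T2 + 2 * T * b i + 2 * (b i * b i)) + 2 * T + 2 * b j + 2 * b i)
       = S * (T * T + T2 + 2 * T * b i + 2 * (b i * b i)) + 2 * T * d + 2 * T + 2 * b i * d"
      by (simp add: sum.distrib S_def T_def d_def sum_distrib_right sum_distrib_left mult_ac)
    finally show ?thesis using ab[of i] by algebra
  qed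
  have 4: "(\<Sum>i\<in>UNIV. a i * (S * (T * T + T2 + 2 * T * b i + 2 * (b i * b i)) + 2 * T * d + 2 * T + 2 * b i * d
      + a i * (T * T + T2) + 4 * T + 6 * b i))
    = (S * S + S2) * (T * T + T2) + 4 * (d + 2) * (S * T) + 2 * d * (d + 3)"
  proof -
    have e: "a i * (S * (T * T + T2 + 2 * T * b i + 2 * (b i * b i)) + 2 * T * d + 2 * T + 2 * b i * d
        + a i * (T * T + T2) + 4 * T + 6 * b i)
      = a i * (S * (T * T + T2) + 2 * T * d + 6 * T) + b i * (2 * S) + (a i * a i) * (T * T + T2)
        + (2 * (S * T) + 2 * d + 6)" for i
      using ab[of i] by algebra
    show ?thesis
      unfolding e sum.distrib sum_distrib_right[symmetric]
      by (simp add: S_def[symmetric] T_def[symmetric] S2_def[symmetric] d_def[symmetric] algebra_simps)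
  qed
  have "(\<Sum>l\<in>UNIV. a i * a j * b k * b l *
      ((1 + of_bool (i = j)) * (1 + of_bool (i = k) + of_bool (j = k))
        * (1 + of_bool (i = l) + of_bool (j = l) + of_bool (k = l))))
    = a i * ((a j * (1 + of_bool (i = j))) * (b k * (1 + of_bool (i = k) + of_bool (j = k)) * (T + b i + b j + b k)))"
    for i j k
    unfolding 1[symmetric] by (simp add: sum_distrib_left mult_ac)
  then show ?thesis by (simp only: sum_distrib_left[symmetric] 2 3 4)
qed

lemma cmod_sum_absq: "cmod (\<Sum>i\<in>UNIV. 1 * complex_of_real (absq x i)) = (norm x)\<^sup>2"
  unfolding mult_1 of_real_sum[symmetric] norm_vec_complex_sq[symmetric] norm_of_real by simp

lemma haar_avg_sq_linear:
  fixes a :: "'d::finite \<Rightarrow> complex"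
  assumes a: "\<And>i. cmod (a i) = 1"
  defines "d \<equiv> real CARD('d)"
  shows "d * (d + 1) * haar_avg (\<lambda>x::complex^'d. (cmod (\<Sum>i\<in>UNIV. a i * complex_of_real (absq x i)))\<^sup>2)
    = (cmod (\<Sum>i\<in>UNIV. a i))\<^sup>2 + d"
proof -
  fix z :: 'd
  \<comment> \<open>Stated for all unit coefficients, because constant coefficients 1 are needed to
    determine the moment.\<close>
  have gen: "haar_avg (\<lambda>x::complex^'d. (cmod (\<Sum>i\<in>UNIV. a i * complex_of_real (absq x i)))\<^sup>2)
    = moment2 z z / 2 * ((cmod (\<Sum>i\<in>UNIV. a i))\<^sup>2 + d)" if a: "\<And>i. cmod (a i) = 1" for a :: "'d \<Rightarrow> complex"
  proof -
    have pt: "(cmod (\<Sum>i\<in>UNIV. a i * complex_of_real (absq x i)))\<^sup>2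
      = (\<Sum>i\<in>UNIV. \<Sum>j\<in>UNIV. Re (a i * cnj (a j)) * (absq x i * absq x j))" for x :: "complex^'d"
    proof -
      have "complex_of_real ((cmod (\<Sum>i\<in>UNIV. a i * complex_of_real (absq x i)))\<^sup>2)
        = (\<Sum>i\<in>UNIV. \<Sum>j\<in>UNIV. (a i * cnj (a j)) * complex_of_real (absq x i * absq x j))"
        unfolding complex_norm_square[of "\<Sum>i\<in>UNIV. f i" for f] cnj_sum sum_product
        by (simp add: mult_ac)
      from arg_cong[OF this, of Re] show ?thesis
        by (simp only: Re_sum Re_complex_of_real Re_mult_of_real)
    qed
    have "haar_avg (\<lambda>x::complex^'d. (cmod (\<Sum>i\<in>UNIV. a i * complex_of_real (absq x i)))\<^sup>2)
      = (\<Sum>i\<in>UNIV. \<Sum>j\<in>UNIV. Re (a i * cnj (a j)) * moment2 i j)"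
      unfolding pt moment2_def by (simp add: haar_avg_sum haar_avg_cmult continuous_intros)
    also have "\<dots> = (\<Sum>i\<in>UNIV. \<Sum>j\<in>UNIV. Re (a i * cnj (a j)) * (moment2 z z / 2 * (1 + of_bool (i = j))))"
      by (subst moment2_eq[of _ _ z]) (rule refl)
    also have "\<dots> = (\<Sum>i\<in>UNIV. \<Sum>j\<in>UNIV. Re (a i * cnj (a j) * (1 + of_bool (i = j))) * (moment2 z z / 2))"
    proof (intro sum.cong refl)
      show "Re (a i * cnj (a j)) * (moment2 z z / 2 * (1 + of_bool (i = j)))
        = Re (a i * cnj (a j) * (1 + of_bool (i = j))) * (moment2 z z / 2)" for i j
        by (cases "i = j") (simp_all add: algebra_simps)
    qed
    also have "\<dots> = Re (\<Sum>i\<in>UNIV. \<Sum>j\<in>UNIV. a i * cnj (a j) * (1 + of_bool (i = j))) * (moment2 z z / 2)"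
      by (simp only: Re_sum sum_distrib_right)
    also have "(\<Sum>i\<in>UNIV. \<Sum>j\<in>UNIV. a i * cnj (a j) * (1 + of_bool (i = j)))
        = complex_of_real ((cmod (\<Sum>i\<in>UNIV. a i))\<^sup>2 + d)"
      unfolding urn_sum2 by (simp add: complex_norm_square[symmetric] a d_def flip: cnj_sum)
    finally show ?thesis by simp
  qed
  \<comment> \<open>With coefficients 1 the weighted sum is the squared norm, so its average is 1;
    this fixes the unknown moment.\<close>
  have "haar_avg (\<lambda>x::complex^'d. (cmod (\<Sum>i\<in>UNIV. 1 * complex_of_real (absq x i)))\<^sup>2) = haar_avg (\<lambda>x::complex^'d. 1)"
    by (rule haar_avg_cong) (intro continuous_intros, intro continuous_intros, simp only: cmod_sum_absq, simp)
  then have "moment2 z z / 2 * (d\<^sup>2 + d) = 1"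
    using gen[of "\<lambda>_. 1"] by (simp add: haar_avg_const d_def)
  moreover have "d * (d + 1) * (moment2 z z / 2 * y) = moment2 z z / 2 * (d\<^sup>2 + d) * y" for y
    by (simp add: power2_eq_square algebra_simps)
  ultimately show ?thesis unfolding gen[OF a] by (simp only: mult_1)
qed

lemma haar_avg_pow4_linear:
  fixes a :: "'d::finite \<Rightarrow> complex"
  assumes a: "\<And>i. cmod (a i) = 1" and d4: "CARD('d) \<ge> 4"
  defines "d \<equiv> real CARD('d)" and "S \<equiv> \<Sum>i\<in>UNIV. a i"
  shows "d * (d + 1) * (d + 2) * (d + 3)
      * haar_avg (\<lambda>x::complex^'d. ((cmod (\<Sum>i\<in>UNIV. a i * complex_of_real (absq x i)))\<^sup>2)\<^sup>2)
    = (cmod (S\<^sup>2 + (\<Sum>i\<in>UNIV. (a i)\<^sup>2)))\<^sup>2 + 4 * (d + 2) * (cmod S)\<^sup>2 + 2 * d * (d + 3)"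
proof -
  fix z :: 'd
  let ?m = "moment4 z z z z / 24"
  have gen: "haar_avg (\<lambda>x::complex^'d. ((cmod (\<Sum>i\<in>UNIV. a i * complex_of_real (absq x i)))\<^sup>2)\<^sup>2)
    = ?m * ((cmod ((\<Sum>i\<in>UNIV. a i)\<^sup>2 + (\<Sum>i\<in>UNIV. (a i)\<^sup>2)))\<^sup>2
        + 4 * (d + 2) * (cmod (\<Sum>i\<in>UNIV. a i))\<^sup>2 + 2 * d * (d + 3))"
    if a: "\<And>i. cmod (a i) = 1" for a :: "'d \<Rightarrow> complex"
  proof -
    let ?r = "\<lambda>i j k l. (1 + of_bool (i = j)) * (1 + of_bool (i = k) + of_bool (j = k))
        * (1 + of_bool (i = l) + of_bool (j = l) + of_bool (k = l))"
    have aa: "a i * cnj (a i) = 1" for i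
      using a[of i] by (metis complex_norm_square of_real_1 power_one)
    have pt: "((cmod (\<Sum>i\<in>UNIV. a i * complex_of_real (absq x i)))\<^sup>2)\<^sup>2
      = (\<Sum>i\<in>UNIV. \<Sum>j\<in>UNIV. \<Sum>k\<in>UNIV. \<Sum>l\<in>UNIV.
          Re (a i * a j * cnj (a k) * cnj (a l)) * (absq x i * absq x j * absq x k * absq x l))" for x :: "complex^'d"
    proof -
      define s where "s = (\<Sum>i\<in>UNIV. a i * complex_of_real (absq x i))"
      have t: "cnj s = (\<Sum>i\<in>UNIV. cnj (a i) * complex_of_real (absq x i))"
        by (simp add: s_def)
      have ss: "s * s = (\<Sum>i\<in>UNIV. \<Sum>j\<in>UNIV. a i * a j * complex_of_real (absq x i * absq x j))"
        unfolding s_def sum_product by (simp add: mult_ac)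
      have tt: "cnj s * cnj s = (\<Sum>k\<in>UNIV. \<Sum>l\<in>UNIV. cnj (a k) * cnj (a l) * complex_of_real (absq x k * absq x l))"
        unfolding t sum_product by (simp add: mult_ac)
      have "complex_of_real (((cmod s)\<^sup>2)\<^sup>2) = (s * s) * (cnj s * cnj s)"
        unfolding of_real_power[of "(cmod s)\<^sup>2"] complex_norm_square by (simp add: power2_eq_square mult_ac)
      also have "\<dots> = (\<Sum>i\<in>UNIV. \<Sum>j\<in>UNIV. \<Sum>k\<in>UNIV. \<Sum>l\<in>UNIV.
          (a i * a j * cnj (a k) * cnj (a l)) * complex_of_real (absq x i * absq x j * absq x k * absq x l))"
        unfolding ss tt sum_distrib_right unfolding sum_distrib_left
        by (simp add: mult_ac)
      finally have "complex_of_real (((cmod s)\<^sup>2)\<^sup>2) = (\<Sum>i\<in>UNIV. \<Sum>j\<in>UNIV. \<Sum>k\<in>UNIV. \<Sum>l\<in>UNIV.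
          (a i * a j * cnj (a k) * cnj (a l)) * complex_of_real (absq x i * absq x j * absq x k * absq x l))" .
      from arg_cong[OF this, of Re] show ?thesis
        by (simp only: Re_sum Re_complex_of_real Re_mult_of_real s_def)
    qed
    have "haar_avg (\<lambda>x::complex^'d. ((cmod (\<Sum>i\<in>UNIV. a i * complex_of_real (absq x i)))\<^sup>2)\<^sup>2)
      = (\<Sum>i\<in>UNIV. \<Sum>j\<in>UNIV. \<Sum>k\<in>UNIV. \<Sum>l\<in>UNIV. Re (a i * a j * cnj (a k) * cnj (a l)) * moment4 i j k l)"
      unfolding pt moment4_def
      by (simp only: haar_avg_sum haar_avg_cmult continuous_intros continuous_on_const continuous_on_id)
    also have "\<dots> = (\<Sum>i\<in>UNIV. \<Sum>j\<in>UNIV. \<Sum>k\<in>UNIV. \<Sum>l\<in>UNIV.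
        Re (a i * a j * cnj (a k) * cnj (a l) * ?r i j k l) * ?m)"
    proof (intro sum.cong refl)
      fix i j k l :: 'd
      have "?r i j k l = complex_of_real (?r i j k l)" by simp
      then have "a i * a j * cnj (a k) * cnj (a l) * ?r i j k l
          = a i * a j * cnj (a k) * cnj (a l) * complex_of_real (?r i j k l)" by simp
      then show "Re (a i * a j * cnj (a k) * cnj (a l)) * moment4 i j k l
        = Re (a i * a j * cnj (a k) * cnj (a l) * ?r i j k l) * ?m"
        unfolding moment4_eq[OF d4, of i j k l z] by (simp only: Re_mult_of_real) (simp only: mult_ac)
    qed
    also have "\<dots> = Re (\<Sum>i\<in>UNIV. \<Sum>j\<in>UNIV. \<Sum>k\<in>UNIV. \<Sum>l\<in>UNIV.
        a i * a j * cnj (a k) * cnj (a l) * ?r i j k l) * ?m"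
      by (simp only: Re_sum sum_distrib_right)
    also have "(\<Sum>i\<in>UNIV. \<Sum>j\<in>UNIV. \<Sum>k\<in>UNIV. \<Sum>l\<in>UNIV. a i * a j * cnj (a k) * cnj (a l) * ?r i j k l)
       = complex_of_real ((cmod ((\<Sum>i\<in>UNIV. a i)\<^sup>2 + (\<Sum>i\<in>UNIV. (a i)\<^sup>2)))\<^sup>2
        + 4 * (d + 2) * (cmod (\<Sum>i\<in>UNIV. a i))\<^sup>2 + 2 * d * (d + 3))"
      unfolding urn_sum4[OF aa] of_real_add of_real_mult complex_norm_square
      by (simp add: power2_eq_square d_def)
    finally show ?thesis by simp
  qed
  \<comment> \<open>Normalisation again: S = S2 = d in the general formula must give 1, whence the
    rising factorial d (d + 1) (d + 2) (d + 3).\<close>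
  have "haar_avg (\<lambda>x::complex^'d. ((cmod (\<Sum>i\<in>UNIV. 1 * complex_of_real (absq x i)))\<^sup>2)\<^sup>2) = haar_avg (\<lambda>x::complex^'d. 1)"
    by (rule haar_avg_cong) (intro continuous_intros, intro continuous_intros, simp only: cmod_sum_absq, simp)
  also have "\<dots> = 1" by (rule haar_avg_const)
  finally have "?m * ((cmod ((complex_of_real d)\<^sup>2 + d))\<^sup>2 + 4 * (d + 2) * d\<^sup>2 + 2 * d * (d + 3)) = 1"
    using gen[of "\<lambda>_. 1"] by (simp add: d_def)
  moreover have "cmod ((complex_of_real d)\<^sup>2 + d) = d\<^sup>2 + d"
    by (metis abs_of_nonneg add_nonneg_nonneg d_def norm_of_real of_nat_0_le_iff of_real_add of_real_power zero_le_power2)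
  moreover have "(d\<^sup>2 + d)\<^sup>2 + 4 * (d + 2) * d\<^sup>2 + 2 * d * (d + 3) = d * (d + 1) * (d + 2) * (d + 3)"
    by (simp add: power2_eq_square algebra_simps)
  ultimately have "?m * (d * (d + 1) * (d + 2) * (d + 3)) = 1"
    by (simp only:)
  moreover have "d * (d + 1) * (d + 2) * (d + 3) * (?m * y) = ?m * (d * (d + 1) * (d + 2) * (d + 3)) * y" for y
    by (simp only: mult_ac)
  ultimately show ?thesis unfolding gen[OF a] S_def by (simp only: mult_1)
qed

section \<open>Geometry of the eigenvalues\<close>

text \<open>The pair condition forces every \<open>l j\<close> other than \<open>l k\<close> to have
  real part above B. As \<open>Re (l k)\<close> is smaller than theirs and \<open>l k\<close> lies
  in the upper half-plane, it is the upper end of the arc; as the pair sums are positive, the arc is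
  shorter than \<pi>. The phase u turns the midpoint of the arc to 1.\<close>

lemma arc_support_aux:
  fixes l :: "'d::finite \<Rightarrow> complex"
  assumes l: "\<And>i. cmod (l i) = 1" and B: "0 < B"
    and pair: "\<And>i j. i \<noteq> j \<Longrightarrow> 2 * B \<le> Re (l i) + Re (l j)"
    and k: "Re (l k) < B" "0 \<le> Im (l k)" and d: "CARD('d) \<ge> 2"
  shows "\<exists>u. cmod u = 1 \<and> (\<forall>i. B \<le> Re (u * l i))"
proof -
  have sq: "(Re (l i))\<^sup>2 + (Im (l i))\<^sup>2 = 1" for i
    using l[of i] by (metis cmod_power2 one_power2)
  have Re1: "\<bar>Re (l i)\<bar> \<le> 1" and Im1: "\<bar>Im (l i)\<bar> \<le> 1" for i
    using l[of i] abs_Re_le_cmod abs_Im_le_cmod by metis+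
  define \<beta> where "\<beta> = arccos (Re (l k))"
  have \<beta>: "0 \<le> \<beta>" "\<beta> \<le> pi" "cos \<beta> = Re (l k)"
    using Re1[of k] by (auto simp: \<beta>_def abs_le_iff arccos_lbound arccos_ubound)
  have "sin \<beta> = Im (l k)"
    using Re1[of k] k(2) sq[of k]
    by (simp add: \<beta>_def abs_le_iff sin_arccos real_sqrt_unique)
  then have lk: "l k = cis \<beta>" using \<beta> by (simp add: complex_eq_iff)
  \<comment> \<open>This is the argument of \<open>l j\<close> when the real part is positive, which
    holds for all j other than k.\<close>
  define \<theta> where "\<theta> j = arcsin (Im (l j))" for j
  have \<theta>: "\<bar>\<theta> j\<bar> \<le> pi / 2" for j
    using Im1[of j] arcsin_bounded[of "Im (l j)"] by (auto simp: \<theta>_def abs_le_iff)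
  have lj: "l j = cis (\<theta> j)" and c1: "cos \<beta> < cos (\<theta> j)" and c2: "- cos \<beta> < cos (\<theta> j)" if "j \<noteq> k" for j
  proof -
    have R: "2 * B \<le> Re (l j) + cos \<beta>" using pair[OF that] \<beta> by simp
    then have "0 < Re (l j)" using k B \<beta> by linarith
    then have "cos (\<theta> j) = Re (l j)"
      using Im1[of j] sq[of j] by (simp add: \<theta>_def abs_le_iff cos_arcsin real_sqrt_unique)
    moreover have "sin (\<theta> j) = Im (l j)" using Im1[of j] by (simp add: \<theta>_def abs_le_iff)
    ultimately show "l j = cis (\<theta> j)" "cos \<beta> < cos (\<theta> j)" "- cos \<beta> < cos (\<theta> j)"
      using R k B \<beta> by (auto simp: complex_eq_iff)
  qed
  have t1: "\<bar>\<theta> j\<bar> < \<beta>" if "j \<noteq> k" for j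
    using c1[OF that] \<theta>[of j] \<beta> cos_mono_less_eq[of "\<beta>" "\<bar>\<theta> j\<bar>"] by auto
  have t2: "\<bar>\<theta> j\<bar> < pi - \<beta>" if "j \<noteq> k" for j
  proof -
    have "cos (pi - \<beta>) < cos \<bar>\<theta> j\<bar>" using c2[OF that] by simp
    then show ?thesis using \<theta>[of j] \<beta> cos_mono_less_eq[of "pi - \<beta>" "\<bar>\<theta> j\<bar>"] by auto
  qed
  have "UNIV - {k} \<noteq> {}"
    using d by (metis Diff_eq_empty_iff card_1_singleton_iff card_mono finite.emptyI finite_insert
        is_singletonI is_singleton_altdef not_less_eq_eq numeral_2_eq_2 One_nat_def)
  then have "Min (\<theta> ` (UNIV - {k})) \<in> \<theta> ` (UNIV - {k})" by (intro Min_in) auto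
  then obtain m' where "Min (\<theta> ` (UNIV - {k})) = \<theta> m'" "m' \<in> UNIV - {k}" by (rule imageE)
  then obtain m where m: "m \<noteq> k" "\<theta> m = Min (\<theta> ` (UNIV - {k}))" by simp
  define \<alpha> where "\<alpha> = \<theta> m"
  have \<alpha>: "\<alpha> \<le> \<theta> j" if "j \<noteq> k" for j
    unfolding \<alpha>_def m(2) using that by (intro Min_le) auto
  have ab: "\<alpha> < \<beta>" "\<beta> - \<alpha> < pi" using t1[OF m(1)] t2[OF m(1)] by (auto simp: \<alpha>_def)
  define u where "u = cis (- ((\<alpha> + \<beta>) / 2))"
  have c0: "0 \<le> cos ((\<beta> - \<alpha>) / 2)" using ab by (intro cos_ge_zero) auto
  \<comment> \<open>The product on the left is the real part of the midpoint of the chord between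
    the ends, and the right side is its modulus, the distance of the chord from the origin.\<close>
  have "cos ((\<beta> - \<alpha>) / 2) * cos ((\<beta> + \<alpha>) / 2) \<le> cos ((\<beta> - \<alpha>) / 2)"
    using c0 by (intro mult_left_le) auto
  moreover have "cos \<beta> + cos \<alpha> = 2 * cos ((\<beta> + \<alpha>) / 2) * cos ((\<beta> - \<alpha>) / 2)"
    by (rule cos_plus_cos)
  moreover have "2 * B \<le> cos \<beta> + cos \<alpha>"
    using pair[of k m] m(1) \<beta> lj[OF m(1)] by (simp add: \<alpha>_def)
  ultimately have Bc: "B \<le> cos ((\<beta> - \<alpha>) / 2)" by (simp add: mult.commute)
  have arc: "B \<le> Re (u * cis t)" if "\<alpha> \<le> t" "t \<le> \<beta>" for t
  proof -
    have "\<bar>t - (\<alpha> + \<beta>) / 2\<bar> \<le> (\<beta> - \<alpha>) / 2"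
      using that by (simp add: abs_le_iff field_simps)
    then have "cos ((\<beta> - \<alpha>) / 2) \<le> cos \<bar>t - (\<alpha> + \<beta>) / 2\<bar>"
      using ab by (intro cos_monotone_0_pi_le) auto
    moreover have "Re (u * cis t) = cos (t - (\<alpha> + \<beta>) / 2)"
      by (simp add: u_def cis_mult)
    ultimately show ?thesis using Bc by simp
  qed
  have "B \<le> Re (u * l j)" for j
  proof (cases "j = k")
    case True
    then show ?thesis using arc[of \<beta>] ab lk by simp
  next
    case False
    then show ?thesis using arc[of "\<theta> j"] \<alpha>[of j] t1[of j] lj[of j] by simp
  qed
  moreover have "cmod u = 1" by (simp add: u_def)
  ultimately show ?thesis by blast
qed

lemma arc_support:
  fixes l :: "'d::finite \<Rightarrow> complex"
  assumes l: "\<And>i. cmod (l i) = 1" and B: "0 < B"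
    and pair: "\<And>i j. i \<noteq> j \<Longrightarrow> 2 * B \<le> Re (l i) + Re (l j)" and d: "CARD('d) \<ge> 2"
  shows "\<exists>u. cmod u = 1 \<and> (\<forall>i. B \<le> Re (u * l i))"
proof (cases "\<forall>i. B \<le> Re (l i)")
  case True
  then show ?thesis by (intro exI[of _ 1]) simp
next
  case False
  then obtain k where k: "Re (l k) < B" by (auto simp: not_le)
  show ?thesis
  proof (cases "0 \<le> Im (l k)")
    case True
    then show ?thesis using arc_support_aux[of l B k] assms k by blast
  next
    case False
    \<comment> \<open>Reflection in the real axis preserves real parts and moves \<open>l k\<close>
      to the upper half-plane.\<close>
    then obtain u where u: "cmod u = 1" "\<And>i. B \<le> Re (u * cnj (l i))"
      using arc_support_aux[of "\<lambda>i. cnj (l i)" B k] assms k by auto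
    have "Re (cnj u * l i) = Re (u * cnj (l i))" for i by simp
    then show ?thesis using u by (metis complex_mod_cnj)
  qed
qed

text \<open>The deviations y from the mean P / d add up to 0: two of them have sum s, the other d -
  2 have sum -s. Cauchy-Schwarz on either group gives s^2 / 2 + s^2 / (d - 2) as a lower bound for
  the sum of the squares, which is where the factor d - 2 under the root comes from.\<close>

lemma pair_mean_lower_bound:
  fixes x :: "'d::finite \<Rightarrow> real" and P Q :: real
  defines "d \<equiv> real CARD('d)"
  assumes d: "CARD('d) \<ge> 3" and ij: "i \<noteq> j"
    and P: "(\<Sum>k\<in>UNIV. x k) = P" and Q: "(\<Sum>k\<in>UNIV. (x k)\<^sup>2) \<le> (Q + d - P\<^sup>2) / 2"
  shows "P / d - sqrt ((d - 2) * (d * Q + d\<^sup>2 - (d + 2) * P\<^sup>2)) / (2 * d) \<le> (x i + x j) / 2"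
proof -
  have d3: "d \<ge> 3" using d by (simp add: d_def)
  define y where "y k = x k - P / d" for k
  define s where "s = y i + y j"
  have split: "(\<Sum>k\<in>UNIV. f k) = f i + f j + (\<Sum>k\<in>UNIV - {i, j}. f k)" for f :: "'d \<Rightarrow> real"
    by (rule sum_UNIV_split_two[OF ij])
  have "(\<Sum>k\<in>UNIV. y k) = 0"
    using d3 by (simp add: y_def sum_subtractf P flip: d_def)
  then have os: "(\<Sum>k\<in>UNIV - {i, j}. y k) = - s" using split[of y] by (simp add: s_def)
  have "real (card (UNIV - {i, j})) = d - 2"
    using ij d by (simp add: card_Diff_subset d_def of_nat_diff)
  then have o: "s\<^sup>2 \<le> (d - 2) * (\<Sum>k\<in>UNIV - {i, j}. (y k)\<^sup>2)"
    using sum_squared_le_sum_of_squares[of y "UNIV - {i, j}"] os by (simp add: mult.commute)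
  have "s\<^sup>2 \<le> 2 * ((y i)\<^sup>2 + (y j)\<^sup>2)"
    using zero_le_power2[of "y i - y j"] by (simp add: s_def power2_eq_square algebra_simps)
  then have "(d - 2) * s\<^sup>2 \<le> (d - 2) * (2 * ((y i)\<^sup>2 + (y j)\<^sup>2))"
    using d3 by (intro mult_left_mono) auto
  with o have "d * s\<^sup>2 \<le> 2 * (d - 2) * (\<Sum>k\<in>UNIV. (y k)\<^sup>2)"
    unfolding split[of "\<lambda>k. (y k)\<^sup>2"] by (simp add: algebra_simps)
  also have "(\<Sum>k\<in>UNIV. (y k)\<^sup>2) = (\<Sum>k\<in>UNIV. (x k)\<^sup>2) - P\<^sup>2 / d"
  proof -
    have "(\<Sum>k\<in>UNIV. (y k)\<^sup>2) = (\<Sum>k\<in>UNIV. (x k)\<^sup>2 - 2 * (P / d) * x k + (P / d)\<^sup>2)"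
      by (simp add: y_def power2_diff algebra_simps)
    also have "\<dots> = (\<Sum>k\<in>UNIV. (x k)\<^sup>2) - 2 * (P / d) * P + d * (P / d)\<^sup>2"
      by (simp add: sum.distrib sum_subtractf P d_def flip: sum_distrib_left sum_divide_distrib)
    finally show ?thesis using d3 by (simp add: power2_eq_square field_simps)
  qed
  also have "2 * (d - 2) * \<dots> \<le> 2 * (d - 2) * ((Q + d - P\<^sup>2) / 2 - P\<^sup>2 / d)"
    using d3 Q by (intro mult_left_mono) auto
  finally have "d * (d * s\<^sup>2) \<le> d * (2 * (d - 2) * ((Q + d - P\<^sup>2) / 2 - P\<^sup>2 / d))"
    using d3 by (intro mult_left_mono) auto
  also have "\<dots> = (d - 2) * (d * Q + d\<^sup>2 - (d + 2) * P\<^sup>2)"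
    using d3 by (simp add: field_simps power2_eq_square)
  finally have "(d * s)\<^sup>2 \<le> (d - 2) * (d * Q + d\<^sup>2 - (d + 2) * P\<^sup>2)"
    by (simp add: power2_eq_square mult_ac)
  then have "\<bar>d * s\<bar> \<le> sqrt ((d - 2) * (d * Q + d\<^sup>2 - (d + 2) * P\<^sup>2))"
    by (metis real_sqrt_abs real_sqrt_le_iff)
  moreover have "P / d - r / (2 * d) \<le> (x i + x j) / 2" if "\<bar>d * s\<bar> \<le> r" for r
  proof -
    have "d * s = d * x i + d * x j - 2 * P" using d3 by (simp add: s_def y_def field_simps)
    then have "2 * P - r \<le> d * x i + d * x j" using that by linarith
    then have "(2 * P - r) / (2 * d) \<le> (d * x i + d * x j) / (2 * d)"
      using d3 by (intro divide_right_mono) auto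
    then show ?thesis using d3 by (simp add: diff_divide_distrib add_divide_distrib)
  qed
  ultimately show ?thesis by blast
qed

section \<open>Unitary channels\<close>

lemma unitary_eigenvalue_norm:
  assumes V: "unitary_mat V" and X: "unitary_mat X" "X = V ** diagm l ** adj V"
  shows "cmod (l i) = 1"
proof -
  have "norm (X *v column i V) = norm (column i V)"
    using X(1) by (intro norm_unitary_mult) (simp add: unitary_mat_def)
  moreover have "X *v column i V = l i *s column i V"
    by (rule spectral_eigenvector[OF V X(2)])
  ultimately show ?thesis by (simp add: norm_scale_vec column_unitary_norm[OF V])
qed

lemma ketbra_mult_vec: "ketbra psi *v v = cip psi v *s psi"
  by (simp add: ketbra_def cip_def matrix_vector_mult_def vec_eq_iff sum_distrib_left mult_ac)

lemma fid_fun_unitary_channel: "fid_fun (unitary_channel X) psi = (cmod (cip psi (X *v psi)))\<^sup>2"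
proof -
  have "qform (unitary_channel X (ketbra psi)) psi = cip psi (adj X *v psi) * cip psi (X *v psi)"
    by (simp add: unitary_channel_def qform_cip matrix_vector_mul_assoc[symmetric] ketbra_mult_vec
        vector_scalar_commute cip_scale_right)
  also have "cip psi (adj X *v psi) = cnj (cip psi (X *v psi))"
    by (simp add: cip_adj[of psi "adj X"] flip: cip_commute)
  finally have "qform (unitary_channel X (ketbra psi)) psi = complex_of_real ((cmod (cip psi (X *v psi)))\<^sup>2)"
    unfolding complex_norm_square by (simp add: mult.commute)
  then show ?thesis unfolding fid_fun_def by simp
qed

text \<open>In the eigenbasis the fidelity is the squared modulus of a sum of the eigenvalues
  weighted by |x_i|^2; changing to that basis is an isometry and does not affect the
  averages.\<close>

lemma fidelity_moments:
  fixes X :: "complex^'d::finite^'d"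
  assumes d4: "CARD('d) \<ge> 4" and V: "unitary_mat V" and X: "unitary_mat X" "X = V ** diagm l ** adj V"
  defines "d \<equiv> real CARD('d)" and "E \<equiv> unitary_channel X" and "S \<equiv> \<Sum>i\<in>UNIV. l i"
  shows "d * (d + 1) * avg_fidelity E = (cmod S)\<^sup>2 + d"
    and "d * (d + 1) * (d + 2) * (d + 3) * ((fid_deviation E)\<^sup>2 + (avg_fidelity E)\<^sup>2)
      = (cmod (S\<^sup>2 + (\<Sum>i\<in>UNIV. (l i)\<^sup>2)))\<^sup>2 + 4 * (d + 2) * (cmod S)\<^sup>2 + 2 * d * (d + 3)"
proof -
  note l = unitary_eigenvalue_norm[OF V X]
  define f where "f = (\<lambda>x::complex^'d. (cmod (\<Sum>i\<in>UNIV. l i * complex_of_real (absq x i)))\<^sup>2)"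
  have cf: "continuous_on UNIV f" unfolding f_def by (intro continuous_intros)
  have fE: "fid_fun E x = f (adj V *v x)" for x
    unfolding E_def f_def fid_fun_unitary_channel X(2) cip_spectral ..
  have lin: "linear ((*v) (adj V))"
    by (rule linearI)
      (simp_all add: matrix_vector_right_distrib vector_scalar_commute flip: of_real_scale_vec)
  have iso: "norm (adj V *v x) = norm x" for x
    using V by (intro norm_unitary_mult) (simp add: unitary_mat_def)
  have F: "avg_fidelity E = haar_avg f"
    unfolding avg_fidelity_def fE by (rule haar_avg_isometry[OF lin iso cf])
  have F2: "haar_avg (\<lambda>x. (fid_fun E x)\<^sup>2) = haar_avg (\<lambda>x. (f x)\<^sup>2)"
    unfolding fE by (rule haar_avg_isometry[OF lin iso]) (intro continuous_intros cf)
  \<comment> \<open>Nonnegativity of the variance is what allows the square to undo the root in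
    \<open>fid_deviation\<close>.\<close>
  have "0 \<le> haar_avg (\<lambda>x. (f x - haar_avg f)\<^sup>2)" by (rule haar_avg_nonneg) simp
  also have "haar_avg (\<lambda>x. (f x - haar_avg f)\<^sup>2)
      = haar_avg (\<lambda>x. (f x)\<^sup>2 + ((- 2 * haar_avg f) * f x + (haar_avg f)\<^sup>2))"
    by (rule arg_cong[where f = haar_avg], rule ext) (simp add: power2_diff algebra_simps)
  also have "\<dots> = haar_avg (\<lambda>x. (f x)\<^sup>2) + haar_avg (\<lambda>x. (- 2 * haar_avg f) * f x + (haar_avg f)\<^sup>2)"
    by (rule haar_avg_add) (intro continuous_intros cf)+
  also have "haar_avg (\<lambda>x. (- 2 * haar_avg f) * f x + (haar_avg f)\<^sup>2)
      = haar_avg (\<lambda>x. (- 2 * haar_avg f) * f x) + haar_avg (\<lambda>x::complex^'d. (haar_avg f)\<^sup>2)"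
    by (rule haar_avg_add) (intro continuous_intros cf)+
  also have "\<dots> = - 2 * haar_avg f * haar_avg f + (haar_avg f)\<^sup>2"
    by (simp only: haar_avg_cmult haar_avg_const)
  finally have "(fid_deviation E)\<^sup>2 + (avg_fidelity E)\<^sup>2 = haar_avg (\<lambda>x. (f x)\<^sup>2)"
    unfolding fid_deviation_def F2 F by (simp add: power2_eq_square)
  then show "d * (d + 1) * (d + 2) * (d + 3) * ((fid_deviation E)\<^sup>2 + (avg_fidelity E)\<^sup>2)
      = (cmod (S\<^sup>2 + (\<Sum>i\<in>UNIV. (l i)\<^sup>2)))\<^sup>2 + 4 * (d + 2) * (cmod S)\<^sup>2 + 2 * d * (d + 3)"
    using haar_avg_pow4_linear[of l, OF l d4] by (simp only: f_def d_def S_def)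
  show "d * (d + 1) * avg_fidelity E = (cmod S)\<^sup>2 + d"
    unfolding F using haar_avg_sq_linear[of l, OF l] by (simp only: f_def d_def S_def)
qed

lemma trace_ketbra_mult: "trace (ketbra psi ** M) = cip psi (M *v psi)"
proof -
  have "trace (ketbra psi ** M) = (\<Sum>i\<in>UNIV. \<Sum>k\<in>UNIV. psi $ i * cnj (psi $ k) * M $ k $ i)"
    by (simp add: trace_def matrix_matrix_mult_def ketbra_def)
  also have "\<dots> = (\<Sum>k\<in>UNIV. \<Sum>i\<in>UNIV. psi $ i * cnj (psi $ k) * M $ k $ i)" by (rule sum.swap)
  finally show ?thesis by (simp add: cip_def matrix_vector_mult_def sum_distrib_left mult_ac)
qed

lemma unitarity_unitary_channel:
  fixes X :: "complex^'d::finite^'d"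
  assumes X: "unitary_mat X" and d2: "CARD('d) \<ge> 2"
  shows "unitarity (unitary_channel X) = 1"
proof -
  define d where "d = real CARD('d)"
  have d: "d \<ge> 2" using d2 by (simp add: d_def)
  let ?c = "complex_of_real (1 / d)"
  have m1: "mat ?c *v v = ?c *s v" for v :: "complex^'d"
    by (simp add: mat_def matrix_vector_mult_def vec_eq_iff if_distrib[where f = "\<lambda>x. x * _"] cong: if_cong)
  have m2: "trace (mat ?c ** M) = ?c * trace M" for M :: "complex^'d^'d"
    by (simp add: mat_def matrix_matrix_mult_def trace_def sum_distrib_left
        if_distrib[where f = "\<lambda>x. x * _"] cong: if_cong)
  have m3: "trace (mat ?c :: complex^'d^'d) = 1"
    using d by (simp add: trace_def mat_def d_def)
  \<comment> \<open>Computed for every x, not just unit vectors: the closed form in the norm shows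
    continuity, after which only its value 1 - 1 / d on the sphere counts.\<close>
  have tr: "Re (trace (unitary_channel X (ketbra x - mat ?c) ** unitary_channel X (ketbra x - mat ?c)))
      = (norm x)^4 - 2 / d * (norm x)\<^sup>2 + 1 / d" for x :: "complex^'d"
  proof -
    let ?K = "ketbra x - mat ?c"
    have X': "adj X ** (X ** M) = M" for M
      using X by (simp add: matrix_mul_assoc unitary_mat_def)
    have "unitary_channel X ?K ** unitary_channel X ?K = (X ** (?K ** ?K)) ** adj X"
      by (simp only: unitary_channel_def matrix_mul_assoc[symmetric] X')
    then have "trace (unitary_channel X ?K ** unitary_channel X ?K) = trace (?K ** ?K)"
      by (simp only: trace_mul_sym[of _ "adj X"] X')
    also have "?K ** ?K = ketbra x ** ?K - mat ?c ** ?K"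
      by (rule matrix_diff_rdistrib)
    also have "trace \<dots> = cip x (?K *v x) - ?c * (trace (ketbra x ** mat 1) - 1)"
      by (simp only: trace_sub trace_ketbra_mult m2 m3 matrix_mul_rid)
    also have "cip x (?K *v x) = cip x x * cip x x - ?c * cip x x"
      by (simp only: matrix_vector_mult_diff_rdistrib ketbra_mult_vec m1 cip_diff_right cip_scale_right)
    also have "trace (ketbra x ** mat 1) = cip x x"
      by (simp only: trace_ketbra_mult matrix_vector_mul_lid)
    finally have "trace (unitary_channel X ?K ** unitary_channel X ?K)
        = complex_of_real ((norm x)\<^sup>2 * (norm x)\<^sup>2 - 1 / d * (norm x)\<^sup>2 - 1 / d * ((norm x)\<^sup>2 - 1))"
      unfolding cip_self by simp
    from arg_cong[OF this, of Re] show ?thesis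
      unfolding Re_complex_of_real by (simp add: power4_eq_xxxx power2_eq_square algebra_simps)
  qed
  have "haar_avg (\<lambda>x. Re (trace (unitary_channel X (ketbra x - mat ?c) ** unitary_channel X (ketbra x - mat ?c))))
      = haar_avg (\<lambda>x::complex^'d. 1 - 1 / d)"
    unfolding tr by (rule haar_avg_cong) (intro continuous_intros, intro continuous_intros, simp)
  then have "unitarity (unitary_channel X) = d / (d - 1) * (1 - 1 / d)"
    unfolding unitarity_def Let_def d_def[symmetric] by (simp only: haar_avg_const)
  also have "\<dots> = 1" using d by (simp add: field_simps)
  finally show ?thesis .
qed

text \<open>In terms of the deficit e = d - P, the left side squared is at most 2 e, since B is at
  least 1 - e and at least 0. The right side squared is d^2 (d^2 - P^2) / 2, at least 32 e because
  d^2 \<ge> 16 and d^2 - P^2 = e (2 d - e) \<ge> 4 e.\<close>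

lemma sqrt_le_B_ru:
  fixes d P F B :: real
  assumes d: "d \<ge> 4" and P: "0 \<le> P" "P \<le> d" and F: "d * (d + 1) * F = P\<^sup>2 + d"
    and B: "0 \<le> B" "1 - (d - P) \<le> B"
  shows "sqrt (1 - B\<^sup>2) \<le> B_ru d (1 - F) 1"
proof -
  define e where "e = d - P"
  have e: "0 \<le> e" "e \<le> d" "P = d - e" using P by (auto simp: e_def)
  have F': "F = (P\<^sup>2 + d) / (d * (d + 1))" using d by (simp add: F[symmetric])
  have r: "1 - F = (d\<^sup>2 - P\<^sup>2) / (d * (d + 1))"
  proof -
    have "1 - F = (d * (d + 1) - (P\<^sup>2 + d)) / (d * (d + 1))"
      unfolding F' using d by (simp add: diff_divide_distrib)
    also have "d * (d + 1) - (P\<^sup>2 + d) = d\<^sup>2 - P\<^sup>2" by (simp add: power2_eq_square algebra_simps)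
    finally show ?thesis .
  qed
  have PP: "P\<^sup>2 \<le> d\<^sup>2" using P d by (intro power_mono) auto
  have nn: "0 \<le> 1 - F" unfolding r using PP d by (intro divide_nonneg_nonneg) auto
  have d16: "(16::real) \<le> d\<^sup>2" using power_mono[of 4 d 2] d by simp
  then have q1: "0 \<le> 1 - 1 / d\<^sup>2" by (simp add: divide_le_eq_1)
  have q2: "0 \<le> 2 * d * (1 - F) / (d - 1)" using nn d by (intro divide_nonneg_nonneg mult_nonneg_nonneg) auto
  have B0: "0 \<le> B_ru d (1 - F) 1"
    unfolding B_ru_def c_d_def using q1 q2 by simp
  have "(B_ru d (1 - F) 1)\<^sup>2 = d^4 * (1 / 4 * (1 - 1 / d\<^sup>2)) * (2 * d * (1 - F) / (d - 1))"
  proof -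
    have "B_ru d (1 - F) 1 = d\<^sup>2 * (1 / 2 * sqrt (1 - 1 / d\<^sup>2)) * sqrt (2 * d * (1 - F) / (d - 1))"
      by (simp add: B_ru_def c_d_def)
    then show ?thesis
      by (simp only: power_mult_distrib real_sqrt_pow2[OF q1] real_sqrt_pow2[OF q2]) (simp add: power_divide)
  qed
  also have "\<dots> = d\<^sup>2 * (d\<^sup>2 - P\<^sup>2) / 2"
  proof -
    have "d^4 * (1 / 4 * (1 - 1 / d\<^sup>2)) = d\<^sup>2 * ((d - 1) * (d + 1)) / 4"
      using d by (simp add: field_simps power2_eq_square power4_eq_xxxx)
    moreover have "2 * d * (1 - F) / (d - 1) = 2 * (d\<^sup>2 - P\<^sup>2) / ((d - 1) * (d + 1))"
      unfolding r using d by (simp add: divide_simps)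
    moreover have "a * b / 4 * (2 * c / b) = a * c / 2" if "b \<noteq> 0" for a b c :: real
      using that by (simp add: field_simps)
    moreover have "(d - 1) * (d + 1) \<noteq> 0" using d by simp
    ultimately show ?thesis by (simp only: not_False_eq_True)
  qed
  finally have sq: "(B_ru d (1 - F) 1)\<^sup>2 = d\<^sup>2 * (d\<^sup>2 - P\<^sup>2) / 2" .
  have "4 * e \<le> d\<^sup>2 - P\<^sup>2"
  proof -
    have "d\<^sup>2 - P\<^sup>2 = e * (2 * d - e)" unfolding e(3) by (simp add: power2_eq_square algebra_simps)
    moreover have "e * 4 \<le> e * (2 * d - e)" using e d by (intro mult_left_mono) auto
    ultimately show ?thesis by simp
  qed
  with d16 have "16 * (4 * e) \<le> d\<^sup>2 * (d\<^sup>2 - P\<^sup>2)"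
    using e by (intro mult_mono) auto
  then have big: "32 * e \<le> d\<^sup>2 * (d\<^sup>2 - P\<^sup>2) / 2" by simp
  have "1 - B\<^sup>2 \<le> 32 * e"
  proof (cases "e \<le> 1")
    case True
    then have "(1 - e)\<^sup>2 \<le> B\<^sup>2" using B by (intro power_mono) (auto simp: e_def)
    moreover have "(1 - e)\<^sup>2 = 1 - 2 * e + e\<^sup>2" by (simp add: power2_diff)
    ultimately show ?thesis using e(1) zero_le_power2[of e] by linarith
  next
    case False
    then show ?thesis using zero_le_power2[of B] by linarith
  qed
  then have "1 - B\<^sup>2 \<le> (B_ru d (1 - F) 1)\<^sup>2" unfolding sq using big by linarith
  then show ?thesis using B0 by (simp add: real_le_lsqrt)
qed

theorem theorem2:
  fixes X :: "complex^'d^'d" and n :: nat and P Q :: real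
  assumes "CARD('d) = 2^n" and "n \<ge> 2"
    and "unitary_mat X"
    and "unital (unitary_channel X)" and "trace_preserving (unitary_channel X)"
    and "P \<ge> 0" and "Q \<ge> 0"
    and "P^2 = real CARD('d) * (real CARD('d) + 1) * avg_fidelity (unitary_channel X) - real CARD('d)"
    and "Q^2 = real CARD('d) * (real CARD('d) + 1) * (real CARD('d) + 2) * (real CARD('d) + 3)
               * ((fid_deviation (unitary_channel X))^2 + (avg_fidelity (unitary_channel X))^2)
             - 2 * real CARD('d) * (real CARD('d) + 3) - 4 * (real CARD('d) + 2) * P^2"
  shows "diamond_dist (unitary_channel X) id
     \<le> min (B_ru (real CARD('d)) (1 - avg_fidelity (unitary_channel X)) (unitarity (unitary_channel X)))
            (B_FD (real CARD('d)) P Q)"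
proof -
  have X: "unitary_mat X" by fact
  have "(2::nat)^2 \<le> 2^n" using assms(2) by (intro power_increasing) auto
  then have d4: "CARD('d) \<ge> 4" using assms(1) by simp
  define d where "d = real CARD('d)"
  have d: "d \<ge> 4" using d4 by (simp add: d_def)
  have "adj X ** X = X ** adj X" using X by (simp add: unitary_mat_def)
  then obtain V l where V: "unitary_mat V" and XV: "X = V ** diagm l ** adj V"
    by (rule normal_spectral)
  have l: "cmod (l i) = 1" for i by (rule unitary_eigenvalue_norm[OF V X XV])
  define S where "S = (\<Sum>i\<in>UNIV. l i)"
  define S2 where "S2 = (\<Sum>i\<in>UNIV. (l i)\<^sup>2)"
  note mom = fidelity_moments[OF d4 V X XV, folded d_def S_def S2_def]
  have "P\<^sup>2 = (cmod S)\<^sup>2" using assms(8) mom(1) by (simp add: d_def[symmetric])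
  then have P: "P = cmod S" using assms(6) by simp
  have "Q\<^sup>2 = (cmod (S\<^sup>2 + S2))\<^sup>2"
    using assms(9) mom(2) by (simp add: d_def[symmetric] P)
  then have Q: "Q = cmod (S\<^sup>2 + S2)" using assms(7) by simp
  obtain w where w: "cmod w = 1" "w * S = complex_of_real P"
    using exists_phase[of S] P by blast
  define x where "x i = Re (w * l i)" for i
  have wl: "cmod (w * l i) = 1" for i by (simp add: norm_mult w l)
  have x1: "x i \<le> 1" for i using complex_Re_le_cmod[of "w * l i"] by (simp add: x_def wl)
  have sx: "(\<Sum>i\<in>UNIV. x i) = P"
    unfolding x_def Re_sum[symmetric] sum_distrib_left[symmetric] S_def[symmetric] w by simp
  have Pd: "P \<le> d" using sum_mono[of UNIV x "\<lambda>_. 1"] x1 sx by (simp add: d_def)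
  have sx2: "(\<Sum>i\<in>UNIV. (x i)\<^sup>2) \<le> (Q + d - P\<^sup>2) / 2"
  proof -
    have "Re ((w * l i)\<^sup>2) = 2 * (x i)\<^sup>2 - 1" for i
    proof -
      have "(Re (w * l i))\<^sup>2 + (Im (w * l i))\<^sup>2 = 1" using wl[of i] by (metis cmod_power2 one_power2)
      moreover have "Re ((w * l i)\<^sup>2) = (Re (w * l i))\<^sup>2 - (Im (w * l i))\<^sup>2"
        by (simp only: Re_power2)
      ultimately show ?thesis unfolding x_def by linarith
    qed
    then have "2 * (\<Sum>i\<in>UNIV. (x i)\<^sup>2) - d = (\<Sum>i\<in>UNIV. Re ((w * l i)\<^sup>2))"
      by (simp add: sum_subtractf sum_distrib_left d_def)
    also have "\<dots> = Re (w\<^sup>2 * S2)"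
      unfolding Re_sum[symmetric] power_mult_distrib sum_distrib_left[symmetric] S2_def ..
    \<comment> \<open>Since w S = P is real, P^2 can be absorbed into the real part as (w S)^2. The
      common factor w^2 then leaves S^2 + S2, whose modulus is Q.\<close>
    finally have "P\<^sup>2 + 2 * (\<Sum>i\<in>UNIV. (x i)\<^sup>2) - d = Re ((w * S)\<^sup>2 + w\<^sup>2 * S2)"
      unfolding w by (simp flip: of_real_power)
    also have "\<dots> = Re (w\<^sup>2 * (S\<^sup>2 + S2))" by (simp only: power_mult_distrib distrib_left)
    also have "\<dots> \<le> cmod (w\<^sup>2 * (S\<^sup>2 + S2))" by (rule complex_Re_le_cmod)
    also have "\<dots> = Q" by (simp add: norm_mult norm_power w Q)
    finally show ?thesis by (simp add: field_simps)
  qed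
  \<comment> \<open>The degenerate half-plane w = 0, B = 0 gives distance at most 1, which settles
    the cases where a lower bound for the real parts is truncated at 0.\<close>
  have zero: "diamond_dist (unitary_channel X) id \<le> sqrt (1 - 0\<^sup>2)"
    by (rule diamond_dist_spectral_le[OF V X XV, where w = 0]) auto
  have "diamond_dist (unitary_channel X) id \<le> B_FD d P Q"
  proof (cases "c_FD d P Q = 0")
    case True
    then show ?thesis using zero by (simp add: B_FD_def)
  next
    case False
    define B where "B = c_FD d P Q"
    have B: "0 < B" "B = P / d - sqrt ((d - 2) * (d * Q + d\<^sup>2 - (d + 2) * P\<^sup>2)) / (2 * d)"
      using False by (auto simp: B_def c_FD_def max_def split: if_splits)
    have "2 * B \<le> Re (w * l i) + Re (w * l j)" if "i \<noteq> j" for i j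
    proof -
      have "B \<le> (x i + x j) / 2"
        unfolding B(2) d_def
        by (rule pair_mean_lower_bound[OF _ that sx sx2[unfolded d_def]]) (use d4 in simp)
      then show ?thesis by (simp add: x_def del: times_complex.sel)
    qed
    then obtain u where u: "cmod u = 1" "\<And>i. B \<le> Re (u * (w * l i))"
      using arc_support[of "\<lambda>i. w * l i" B] wl B(1) d4 by auto
    have "diamond_dist (unitary_channel X) id \<le> sqrt (1 - B\<^sup>2)"
      by (rule diamond_dist_spectral_le[OF V X XV, where w = "u * w"])
        (use B(1) u w in \<open>auto simp: norm_mult mult.assoc simp del: times_complex.sel\<close>)
    then show ?thesis by (simp add: B_FD_def B_def)
  qed
  moreover have "diamond_dist (unitary_channel X) id \<le> B_ru d (1 - avg_fidelity (unitary_channel X)) 1"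
  proof -
    define B where "B = max 0 (1 - (d - P))"
    have "diamond_dist (unitary_channel X) id \<le> sqrt (1 - B\<^sup>2)"
    proof (cases "1 - (d - P) \<le> 0")
      case True
      then show ?thesis using zero by (simp add: B_def)
    next
      case False
      \<comment> \<open>The real parts have sum P, and the other d - 1 of them are at most 1
        each.\<close>
      have "1 - (d - P) \<le> x i" for i
      proof -
        have "P = x i + (\<Sum>j\<in>UNIV - {i}. x j)" using sum.remove[of UNIV i x] sx by simp
        also have "(\<Sum>j\<in>UNIV - {i}. x j) \<le> (\<Sum>j\<in>UNIV - {i}. 1)" by (intro sum_mono x1)
        also have "\<dots> = d - 1" using d4 by (simp add: d_def card_Diff_singleton of_nat_diff)
        finally show ?thesis by linarith
      qed
      then show ?thesis
        by (intro diamond_dist_spectral_le[OF V X XV, where w = w])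
          (use False in \<open>auto simp: B_def w x_def\<close>)
    qed
    also have "\<dots> \<le> B_ru d (1 - avg_fidelity (unitary_channel X)) 1"
      by (rule sqrt_le_B_ru[OF d assms(6) Pd]) (use mom(1) in \<open>auto simp: B_def P\<close>)
    finally show ?thesis .
  qed
  ultimately show ?thesis
    using unitarity_unitary_channel[OF X] d4 by (simp add: d_def)
qed

end
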